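(* Let $n\ge 1$, let $\mathbf{A},\mathbf{B}\in \mathrm{M}(n,\mathbb{H})$ be given, and consider the right matrix equation $\mathbf{A}\mathbf{X}=\mathbf{B}$ with unknown $\mathbf{X}=(x_{ij})\in \mathrm{M}(n,\mathbb{H})$. If $\mathrm{ddet}\,\mathbf{A}\neq 0$, then this equation has a unique solution, and the solution is given by $$x_{ij}=\frac{\mathrm{cdet}_{i}\,(\mathbf{A}^{*}\mathbf{A})_{.i}\left(\hat{\mathbf{b}}_{.j}\right)}{\mathrm{ddet}\,\mathbf{A}}\qquad\text{for all } i,j=1,\ldots,n,$$ where $\hat{\mathbf{b}}_{.j}$ is the $j$th column of $\hat{\mathbf{B}}:=\mathbf{A}^{*}\mathbf{B}$.
   Context: $\mathbb{H}$ is the (real) quaternion skew field and $\mathrm{M}(n,\mathbb{H})$ the ring of $n\times n$ quaternion matrices. For $\mathbf{A}=(a_{ij})$, $\mathbf{A}^{*}$ is the Hermitian adjoint (conjugate transpose); $\mathbf{A}$ is Hermitian if $\mathbf{A}^*=\mathbf{A}$. For a square matrix $\mathbf{M}$ and a column $\mathbf{b}$, $\mathbf{M}_{.i}(\mathbf{b})$ denotes the matrix obtained from $\mathbf{M}$ by replacing its $i$th column with $\mathbf{b}$. Row determinants. For $\mathbf{A}=(a_{ij})\in \mathrm{M}(n,\mathbb{H})$ and $i\in\{1,\ldots,n\}$, $$\mathrm{rdet}_i\,\mathbf{A}=\sum_{\sigma\in S_n}(-1)^{n-r}\,\bigl(a_{i\,i_{k_1}}a_{i_{k_1}i_{k_1+1}}\cdots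 a_{i_{k_1+l_1}i}\bigr)\cdots\bigl(a_{i_{k_r}i_{k_r+1}}\cdots a_{i_{k_r+l_r}i_{k_r}}\bigr),$$ where each $\sigma\in S_n$ is written as a product of its $r$ disjoint cycles (fixed points counted as cycles of length one, contributing a diagonal entry) in the left-ordered form $$\sigma=(i\,i_{k_1}i_{k_1+1}\ldots i_{k_1+l_1})(i_{k_2}i_{k_2+1}\ldots i_{k_2+l_2})\cdots(i_{k_r}i_{k_r+1}\ldots i_{k_r+l_r}),$$ in which $i$ opens the first cycle from the left, and $i_{k_2}<i_{k_3}<\cdots<i_{k_r}$ and $i_{k_t}<i_{k_t+s}$ for $t=2,\ldots,r$, $s=1,\ldots,l_t$. The order of the factors in each product is exactly as written. Column determinants. For $j\in\{1,\ldots,n\}$, $$\mathrm{cdet}_j\,\mathbf{A}=\sum_{\tau\in S_n}(-1)^{n-r}\,\bigl(a_{j_{k_r}j_{k_r+l_r}}\cdots a_{j_{k_r+1}j_{k_r}}\bigr)\cdots\bigl(a_{j\,j_{k_1+l_1}}\cdots a_{j_{k_1+1}j_{k_1}}a_{j_{k_1}j}\bigr),$$ where each $\tau\in S_n$ is written as a product of its $r$ disjoint cycles (fixed points included) in the right-ordered form $$\tau=(j_{k_r+l_r}\ldots j_{k_r+1}j_{k_r})\cdots(j_{k_2+l_2}\ldots j_{k_2+1}j_{k_2})(j_{k_1+l_1}\ldots j_{k_1+1}j_{k_1}j),$$ in which $j$ opens the first cycle from the right, and $j_{k_2}<j_{k_3}<\cdots<j_{k_r}$ and $j_{k_t}<j_{k_t+s}$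 for $t=2,\ldots,r$, $s=1,\ldots,l_t$. Double determinant. It is known that for a Hermitian matrix $\mathbf{M}\in\mathrm{M}(n,\mathbb{H})$ all the values $\mathrm{rdet}_1\mathbf{M},\ldots,\mathrm{rdet}_n\mathbf{M},\mathrm{cdet}_1\mathbf{M},\ldots,\mathrm{cdet}_n\mathbf{M}$ coincide and are real; this common value is $\det\mathbf{M}$. It is also known that $\det(\mathbf{A}^*\mathbf{A})=\det(\mathbf{A}\mathbf{A}^* )$ for $\mathbf{A}\in \mathrm{M}(n,\mathbb{H})$; the double determinant is $\mathrm{ddet}\,\mathbf{A}:=\det(\mathbf{A}^{*}\mathbf{A})=\det(\mathbf{A}\mathbf{A}^{*})\in\mathbb{R}$. *)

theory Defs
  imports "Jordan_Normal_Form.Determinant" "HOL-Combinatorics.Cycles" "HOL.Real_Vector_Spaces"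
begin

section \<open>Quaternions\<close>

datatype quat = Quat (qre: real) (qi: real) (qj: real) (qk: real)

lemma quat_eq_iff: "x = y \<longleftrightarrow> qre x = qre y \<and> qi x = qi y \<and> qj x = qj y \<and> qk x = qk y"
  by (cases x; cases y) simp

definition qcnj :: "quat \<Rightarrow> quat" where
  "qcnj x = Quat (qre x) (- qi x) (- qj x) (- qk x)"

lemma qcnj_sel [simp]:
  "qre (qcnj x) = qre x" "qi (qcnj x) = - qi x" "qj (qcnj x) = - qj x" "qk (qcnj x) = - qk x"
  by (simp_all add: qcnj_def)

instantiation quat :: ab_group_add
begin

definition "0 = Quat 0 0 0 0"
definition "x + y = Quat (qre x + qre y) (qi x + qi y) (qj x + qj y) (qk x + qk y)"
definition "- x = Quat (- qre x) (- qi x) (- qj x) (- qk x)"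
definition "x - y = Quat (qre x - qre y) (qi x - qi y) (qj x - qj y) (qk x - qk y)"

instance
  by standard
    (simp_all add: quat_eq_iff zero_quat_def plus_quat_def uminus_quat_def minus_quat_def)

end

lemma quat_add_sel [simp]:
  "qre 0 = 0" "qi 0 = 0" "qj 0 = 0" "qk 0 = 0"
  "qre (x + y) = qre x + qre y" "qi (x + y) = qi x + qi y"
  "qj (x + y) = qj x + qj y" "qk (x + y) = qk x + qk y"
  "qre (- x) = - qre x" "qi (- x) = - qi x" "qj (- x) = - qj x" "qk (- x) = - qk x"
  "qre (x - y) = qre x - qre y" "qi (x - y) = qi x - qi y"
  "qj (x - y) = qj x - qj y" "qk (x - y) = qk x - qk y"
  by (simp_all add: zero_quat_def plus_quat_def uminus_quat_def minus_quat_def)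

instantiation quat :: real_div_algebra
begin

definition "1 = Quat 1 0 0 0"

definition "x * y = Quat
  (qre x * qre y - qi x * qi y - qj x * qj y - qk x * qk y)
  (qre x * qi y + qi x * qre y + qj x * qk y - qk x * qj y)
  (qre x * qj y - qi x * qk y + qj x * qre y + qk x * qi y)
  (qre x * qk y + qi x * qj y - qj x * qi y + qk x * qre y)"

definition "r *\<^sub>R x = Quat (r * qre x) (r * qi x) (r * qj x) (r * qk x)"

definition "inverse x =
  inverse ((qre x)\<^sup>2 + (qi x)\<^sup>2 + (qj x)\<^sup>2 + (qk x)\<^sup>2) *\<^sub>R qcnj x"

definition "x div y = x * inverse y" for x y :: quat

lemma sq_sum_nonzero:
  assumes "x \<noteq> 0"
  shows "(qre x)\<^sup>2 + (qi x)\<^sup>2 + (qj x)\<^sup>2 + (qk x)\<^sup>2 \<noteq> 0"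
  using assms by (auto simp: quat_eq_iff add_nonneg_eq_0_iff)

instance
proof
  fix x :: quat
  assume nz: "x \<noteq> 0"
  define N where "N = (qre x)\<^sup>2 + (qi x)\<^sup>2 + (qj x)\<^sup>2 + (qk x)\<^sup>2"
  have N: "N \<noteq> 0" using sq_sum_nonzero[OF nz] by (simp add: N_def)
  have *: "inverse x = Quat (qre x / N) (- qi x / N) (- qj x / N) (- qk x / N)"
    by (simp add: inverse_quat_def scaleR_quat_def N_def divide_inverse mult.commute)
  have **: "(qre x * qre x + qi x * qi x + qj x * qj x + qk x * qk x) / N = 1"
    using N by (simp add: N_def power2_eq_square)
  show "inverse x * x = 1" "x * inverse x = 1"
    unfolding * using **
    by (simp_all add: times_quat_def one_quat_def add_divide_distrib algebra_simps)
next
  show "inverse (0::quat) = 0"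
    by (simp add: inverse_quat_def scaleR_quat_def quat_eq_iff)
qed (simp_all add: quat_eq_iff times_quat_def one_quat_def scaleR_quat_def divide_quat_def
      algebra_simps)

end

section \<open>Quaternion matrices and their row and column determinants\<close>

definition adjoint_qmat :: "quat mat \<Rightarrow> quat mat" where
  "adjoint_qmat A = map_mat qcnj (transpose_mat A)"

text \<open>
  Matrix indices are \<open>0, \<dots>, n - 1\<close>. The list \<open>support \<sigma> k = [k, \<sigma> k, \<sigma> (\<sigma> k), \<dots>]\<close> is the
  cycle of \<open>\<sigma>\<close> through \<open>k\<close>, written with \<open>k\<close> in front (\<open>[k]\<close> for a fixed point).
  The list below consists of the opening elements of the cycles of \<open>\<sigma>\<close>: first the
  distinguished index \<open>i\<close>, then the minimal elements of the remaining cycles, in increasing order.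
\<close>

definition openers :: "nat \<Rightarrow> nat \<Rightarrow> (nat \<Rightarrow> nat) \<Rightarrow> nat list" where
  "openers n i \<sigma> =
     i # filter (\<lambda>k. k \<notin> set (support \<sigma> i) \<and> (\<forall>l \<in> set (support \<sigma> k). k \<le> l)) [0..<n]"

text \<open>
  The ordered product of the entries along the cycle through \<open>k\<close>: the first factor is in row \<open>k\<close>,
  the last one in column \<open>k\<close>.
\<close>

definition cycle_product :: "quat mat \<Rightarrow> (nat \<Rightarrow> nat) \<Rightarrow> nat \<Rightarrow> quat" where
  "cycle_product A \<sigma> k = prod_list (map (\<lambda>l. A $$ (l, \<sigma> l)) (support \<sigma> k))"

definition rdet :: "nat \<Rightarrow> quat mat \<Rightarrow> quat" where
  "rdet i A = (\<Sum>\<sigma> | \<sigma> permutes {0..<dim_row A}.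
     (-1) ^ (dim_row A - length (openers (dim_row A) i \<sigma>)) *
     prod_list (map (cycle_product A \<sigma>) (openers (dim_row A) i \<sigma>)))"

text \<open>
  In the right-ordered form a cycle \<open>(j\<^sub>m \<dots> j\<^sub>1 j)\<close> opens from the right with \<open>j\<close>, so the
  permutation maps \<open>j\<close> to \<open>j\<^sub>m\<close>, \<open>j\<^sub>m\<close> to \<open>j\<^sub>m\<^sub>-\<^sub>1\<close>, and finally \<open>j\<^sub>1\<close> to \<open>j\<close>. Its contribution
  \<open>a(j, j\<^sub>m) \<dots> a(j\<^sub>2, j\<^sub>1) a(j\<^sub>1, j)\<close> is thus again the cycle product starting in row \<open>j\<close>;
  what distinguishes column from row determinants is that the cycles are multiplied in the
  opposite order.
\<close>

definition cdet :: "nat \<Rightarrow> quat mat \<Rightarrow> quat" where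
  "cdet j A = (\<Sum>\<tau> | \<tau> permutes {0..<dim_row A}.
     (-1) ^ (dim_row A - length (openers (dim_row A) j \<tau>)) *
     prod_list (map (cycle_product A \<tau>) (rev (openers (dim_row A) j \<tau>))))"

text \<open>
  The determinant of a Hermitian matrix, as the common real value of all its row and column
  determinants. It is unspecified for matrices without such a common value.
\<close>

definition hdet :: "quat mat \<Rightarrow> real" where
  "hdet M = (THE d. \<forall>i < dim_row M. rdet i M = of_real d \<and> cdet i M = of_real d)"

definition ddet :: "quat mat \<Rightarrow> real" where
  "ddet A = hdet (adjoint_qmat A * A)"

end

theory Submission
  imports Defs
begin

text \<open>
  Reversing one cycle of a permutation conjugates its cycle product when the matrix is Hermitian along
  that cycle, so in a row or column determinant each such cycle product may be replaced by its real part.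
  Real parts of cycle products are central and do not depend on the opening element: hence all row and
  column determinants of a Hermitian matrix \<open>M\<close> agree and are real, and \<open>cdet i\<close> vanishes when column
  \<open>i\<close> of \<open>M\<close> is replaced by another of its columns. As \<open>cdet i\<close> is right linear in column \<open>i\<close>, this
  yields Cramer's rule for \<open>M * X = A\<^sup>* * B\<close> with \<open>M = A\<^sup>* * A\<close> and a left inverse of \<open>A\<close>,
  which a trace argument shows to be a right inverse as well.
\<close>

section \<open>Cycles of a permutation as lists\<close>

text \<open>The factors of a row or column determinant are ordered, and the order depends on the
  distinguished index, so no factor may be moved until it is known to be central. Inverting one
  cycle keeps every cycle as a set, hence the openers, their order and the sign; averaging can
  therefore treat one factor at a time, each in its place. Once column \<open>i\<close> is replaced,
  the cycle through \<open>i\<close> escapes this, since the matrix need no longer be Hermitian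
  along it. But \<open>cdet i\<close> puts that cycle last, and the entry of column \<open>i\<close>
  closes it, so the replaced column stands at the far right of every summand. Its coefficients then
  form a row of a matrix \<open>L\<close> acting from the left, and Cramer's rule becomes
  \<open>L * M = 1\<close>. This settles uniqueness and the formula. Existence needs
  \<open>C = L * A\<^sup>*\<close> to be a right inverse of \<open>A\<close>: here \<open>L\<close>
  is Hermitian, because its adjoint is a right inverse of \<open>M\<close>, so
  \<open>A * C = A * L * A\<^sup>*\<close> is Hermitian too, and that symmetry feeds the trace
  argument.\<close>

definition is_cycle :: "('a \<Rightarrow> 'a) \<Rightarrow> 'a list \<Rightarrow> bool" where
  "is_cycle \<sigma> xs \<longleftrightarrow> xs \<noteq> [] \<and> distinct xs \<and> map \<sigma> xs = rotate1 xs"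

text \<open>A constant of its own keeps \<open>support\<close>, a map over powers of
  \<open>\<sigma>\<close>, from being simplified into its parts, so that cycles can be handled as
  plain lists.\<close>

definition cycle_from :: "('a \<Rightarrow> 'a) \<Rightarrow> 'a \<Rightarrow> 'a list" where
  "cycle_from \<sigma> k = support \<sigma> k"

text \<open>The rotation equation fixes all powers of \<open>\<sigma>\<close> at
  \<open>hd xs\<close>, and distinctness makes \<open>length xs\<close> the least period. Cycles of
  modified permutations are computed below by exhibiting a list that satisfies this
  equation.\<close>

lemma cycle_from_unique:
  assumes "is_cycle \<sigma> xs"
  shows "cycle_from \<sigma> (hd xs) = xs"
proof -
  from assms have ne: "xs \<noteq> []" and d: "distinct xs" and m: "map \<sigma> xs = rotate1 xs"
    by (auto simp: is_cycle_def)
  have step: "\<sigma> (xs ! t) = xs ! (Suc t mod length xs)" if "t < length xs" for t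
    using that m nth_map[of t xs \<sigma>] nth_rotate1[of t xs] by simp
  have pow: "(\<sigma> ^^ t) (hd xs) = xs ! (t mod length xs)" for t
  proof (induction t)
    case 0
    then show ?case using ne by (simp add: hd_conv_nth)
  next
    case (Suc t)
    then show ?case using ne step[of "t mod length xs"] by (simp add: mod_Suc_eq)
  qed
  have "least_power \<sigma> (hd xs) = length xs"
    unfolding least_power_def
  proof (rule Least_equality)
    show "(\<sigma> ^^ length xs) (hd xs) = hd xs \<and> 0 < length xs"
      using ne pow[of "length xs"] by (simp add: hd_conv_nth)
    fix y assume y: "(\<sigma> ^^ y) (hd xs) = hd xs \<and> 0 < y"
    show "length xs \<le> y"
    proof (rule ccontr)
      assume "\<not> length xs \<le> y"
      then have "xs ! y = xs ! 0" using y ne pow[of y] by (simp add: hd_conv_nth)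
      with d ne \<open>\<not> length xs \<le> y\<close> y show False by (simp add: nth_eq_iff_index_eq)
    qed
  qed
  then show ?thesis
    unfolding cycle_from_def by (intro nth_equalityI) (auto simp: pow)
qed

lemma is_cycle_cycle_from:
  assumes "permutation \<sigma>"
  shows "is_cycle \<sigma> (cycle_from \<sigma> k)"
proof -
  note lp = least_power_of_permutation[OF assms, of k]
  have "map \<sigma> (support \<sigma> k) = rotate1 (support \<sigma> k)"
  proof (rule nth_equalityI)
    fix t assume "t < length (map \<sigma> (support \<sigma> k))"
    then have t: "t < least_power \<sigma> k" by simp
    then have "Suc t < least_power \<sigma> k \<or> Suc t = least_power \<sigma> k" by linarith
    then show "map \<sigma> (support \<sigma> k) ! t = rotate1 (support \<sigma> k) ! t"
      using t lp funpow.simps(2)[of t \<sigma>]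
      by (auto simp: nth_rotate1 simp del: funpow.simps)
  qed simp
  then show ?thesis
    using cycle_of_permutation[OF assms, of k] lp(2) by (simp add: is_cycle_def cycle_from_def)
qed

lemma cycle_from_cong:
  assumes "permutation \<sigma>" "\<And>x. x \<in> set (cycle_from \<sigma> k) \<Longrightarrow> \<rho> x = \<sigma> x"
  shows "cycle_from \<rho> k = cycle_from \<sigma> k"
proof -
  have c: "is_cycle \<sigma> (cycle_from \<sigma> k)" by (rule is_cycle_cycle_from[OF assms(1)])
  moreover have "hd (cycle_from \<sigma> k) = k"
    using least_power_of_permutation(2)[OF assms(1), of k] by (simp add: cycle_from_def hd_map)
  moreover have "is_cycle \<rho> (cycle_from \<sigma> k)"
    using c assms(2) by (simp add: is_cycle_def cong: map_cong)
  ultimately show ?thesis using cycle_from_unique by metis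
qed

lemma cycle_from_Cons:
  assumes "permutation \<sigma>"
  obtains ys where "cycle_from \<sigma> k = k # ys" "k \<notin> set ys" "distinct ys" "map \<sigma> (k # ys) = ys @ [k]"
proof -
  have c: "is_cycle \<sigma> (cycle_from \<sigma> k)" by (rule is_cycle_cycle_from[OF assms(1)])
  moreover have "hd (cycle_from \<sigma> k) = k"
    using least_power_of_permutation(2)[OF assms(1), of k] by (simp add: cycle_from_def hd_map)
  ultimately show ?thesis
    using that by (cases "cycle_from \<sigma> k") (auto simp: is_cycle_def)
qed

lemma in_cycle_from_self [simp]: "permutation \<sigma> \<Longrightarrow> k \<in> set (cycle_from \<sigma> k)"
  by (rule cycle_from_Cons[of \<sigma> k]) simp_all

lemma cycle_from_rotate:
  assumes "permutation \<sigma>" "cycle_from \<sigma> k = us @ l # vs"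
  shows "cycle_from \<sigma> l = l # vs @ us"
proof -
  have "is_cycle \<sigma> (us @ l # vs)" using is_cycle_cycle_from[OF assms(1), of k] assms(2) by simp
  then have "is_cycle \<sigma> (l # vs @ us)"
  proof (cases us)
    case (Cons a as)
    with \<open>is_cycle \<sigma> (us @ l # vs)\<close>
    have "map \<sigma> us @ map \<sigma> (l # vs) = (as @ [l]) @ (vs @ [a])"
      by (simp add: is_cycle_def)
    \<comment> \<open>The blocks on both sides have equal lengths, so the equation splits at the
      boundary.\<close>
    then have "map \<sigma> us = as @ [l]" "map \<sigma> (l # vs) = vs @ [a]"
      by (subst (asm) append_eq_append_conv; simp add: Cons)+
    with Cons \<open>is_cycle \<sigma> (us @ l # vs)\<close> show ?thesis
      by (auto simp: is_cycle_def)
  qed simp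
  from cycle_from_unique[OF this] show ?thesis by simp
qed

lemma set_cycle_from_eq:
  assumes "permutation \<sigma>" "l \<in> set (cycle_from \<sigma> k)"
  shows "set (cycle_from \<sigma> l) = set (cycle_from \<sigma> k)"
proof -
  obtain us vs where "cycle_from \<sigma> k = us @ l # vs" using assms(2) by (meson split_list)
  with cycle_from_rotate[OF assms(1) this] show ?thesis by auto
qed

lemma cycle_from_disjoint:
  assumes "permutation \<sigma>" "l \<notin> set (cycle_from \<sigma> k)"
  shows "set (cycle_from \<sigma> l) \<inter> set (cycle_from \<sigma> k) = {}"
  using assms set_cycle_from_eq[OF assms(1)] in_cycle_from_self[OF assms(1)] by blast

lemma apply_in_cycle_from:
  assumes "permutation \<sigma>" "x \<in> set (cycle_from \<sigma> k)"
  shows "\<sigma> x \<in> set (cycle_from \<sigma> k)"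
proof -
  obtain ys where "cycle_from \<sigma> k = k # ys" "map \<sigma> (k # ys) = ys @ [k]"
    using cycle_from_Cons[OF assms(1)] by metis
  then show ?thesis using assms(2) by (metis image_eqI list.set_map rotate1.simps(2) set_rotate1)
qed

lemma apply_in_cycle_from_iff:
  assumes "permutation \<sigma>"
  shows "\<sigma> x \<in> set (cycle_from \<sigma> k) \<longleftrightarrow> x \<in> set (cycle_from \<sigma> k)"
  using apply_in_cycle_from[OF assms] set_cycle_from_eq[OF assms] in_cycle_from_self[OF assms]
  by metis

lemma cycle_from_subset:
  assumes "\<sigma> permutes S" "finite S" "k \<in> S"
  shows "set (cycle_from \<sigma> k) \<subseteq> S"
proof
  fix x assume "x \<in> set (cycle_from \<sigma> k)"
  then obtain t where "x = (\<sigma> ^^ t) k" by (auto simp: cycle_from_def)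
  then show "x \<in> S" using permutes_in_image[OF permutes_funpow[OF assms(1)]] assms(3) by metis
qed

section \<open>Reversing a single cycle\<close>

definition reverse_cycle :: "'a \<Rightarrow> ('a \<Rightarrow> 'a) \<Rightarrow> 'a \<Rightarrow> 'a" where
  "reverse_cycle k \<sigma> x = (if x \<in> set (cycle_from \<sigma> k) then inv_into UNIV \<sigma> x else \<sigma> x)"

lemma reverse_cycle_permutes:
  assumes "\<sigma> permutes S" "finite S"
  shows "reverse_cycle k \<sigma> permutes S"
proof -
  have p: "permutation \<sigma>" using assms by (auto simp: permutation_permutes)
  have bij: "bij \<sigma>" using assms(1) by (rule permutes_bij)
  let ?C = "set (cycle_from \<sigma> k)"
  have inC: "inv_into UNIV \<sigma> x \<in> ?C \<longleftrightarrow> x \<in> ?C" for x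
    using apply_in_cycle_from_iff[OF p, of "inv_into UNIV \<sigma> x" k] bij by (simp add: bij_is_surj surj_f_inv_f)
  have "inj (reverse_cycle k \<sigma>)"
  proof (rule injI)
    fix x y assume e: "reverse_cycle k \<sigma> x = reverse_cycle k \<sigma> y"
    then have "x \<in> ?C \<longleftrightarrow> y \<in> ?C"
      using inC apply_in_cycle_from_iff[OF p] by (metis reverse_cycle_def)
    with e show "x = y"
      by (metis bij bij_inv_eq_iff reverse_cycle_def)
  qed
  moreover have "reverse_cycle k \<sigma> x = x" if "x \<notin> S" for x
    using that assms(1) permutes_inv[OF assms(1)] by (simp add: reverse_cycle_def permutes_not_in)
  moreover have "reverse_cycle k \<sigma> x \<in> S" if "x \<in> S" for x
    using that assms(1) permutes_inv[OF assms(1)] by (simp add: reverse_cycle_def permutes_in_image)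
  ultimately show ?thesis
    using assms(2) by (intro inj_imp_permutes) (auto intro: inj_on_subset)
qed

lemma cycle_from_reverse_cycle_other:
  assumes "permutation \<sigma>" "l \<notin> set (cycle_from \<sigma> k)"
  shows "cycle_from (reverse_cycle k \<sigma>) l = cycle_from \<sigma> l"
  using cycle_from_disjoint[OF assms]
  by (intro cycle_from_cong[OF assms(1)]) (auto simp: reverse_cycle_def)

text \<open>Applying the inverse to \<open>map \<sigma> (k # ys) = ys @ [k]\<close> and reversing
  both sides gives the rotation equation for \<open>k # rev ys\<close>; the opener \<open>k\<close>
  stays in front.\<close>

lemma cycle_from_reverse_cycle_same:
  assumes "permutation \<sigma>"
  shows "cycle_from (reverse_cycle k \<sigma>) k = k # rev (tl (cycle_from \<sigma> k))"
proof -
  obtain ys where ys: "cycle_from \<sigma> k = k # ys" "k \<notin> set ys" "distinct ys"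
    "map \<sigma> (k # ys) = ys @ [k]"
    using cycle_from_Cons[OF assms(1)] by metis
  have inj: "inj \<sigma>" using assms by (simp add: permutation bij_is_inj)
  have "map (inv_into UNIV \<sigma>) (map \<sigma> (k # ys)) = k # ys"
    using inj by (simp only: map_map inv_o_cancel) simp
  then have "map (inv_into UNIV \<sigma>) (ys @ [k]) = k # ys" unfolding ys(4) .
  then have "rev (map (inv_into UNIV \<sigma>) (ys @ [k])) = rev (k # ys)" by simp
  then have inv: "map (inv_into UNIV \<sigma>) (k # rev ys) = rev ys @ [k]" by (simp add: rev_map)
  have "map (reverse_cycle k \<sigma>) (k # rev ys) = map (inv_into UNIV \<sigma>) (k # rev ys)"
    using ys(1) by (intro map_cong) (auto simp: reverse_cycle_def)
  then have "is_cycle (reverse_cycle k \<sigma>) (k # rev ys)"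
    unfolding is_cycle_def using ys(2,3) inv by (simp only: rotate1.simps) simp
  from cycle_from_unique[OF this] ys(1) show ?thesis by simp
qed

text \<open>This is what protects the minima of the cycles, and with them the openers, their order
  and the sign.\<close>

lemma set_cycle_from_reverse_cycle:
  assumes "\<sigma> permutes S" "finite S"
  shows "set (cycle_from (reverse_cycle k \<sigma>) l) = set (cycle_from \<sigma> l)"
proof -
  have p: "permutation \<sigma>" and p': "permutation (reverse_cycle k \<sigma>)"
    using assms reverse_cycle_permutes[OF assms] by (auto simp: permutation_permutes)
  have k: "set (cycle_from (reverse_cycle k \<sigma>) k) = set (cycle_from \<sigma> k)"
    by (rule cycle_from_Cons[OF p, of k]) (simp add: cycle_from_reverse_cycle_same[OF p, of k])
  show ?thesis
  proof (cases "l \<in> set (cycle_from \<sigma> k)")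
    case True
    then show ?thesis
      using k set_cycle_from_eq[OF p True] set_cycle_from_eq[OF p', of l k] by simp
  qed (simp add: cycle_from_reverse_cycle_other[OF p])
qed

lemma reverse_cycle_reverse_cycle:
  assumes "\<sigma> permutes S" "finite S"
  shows "reverse_cycle k (reverse_cycle k \<sigma>) = \<sigma>"
proof
  fix x
  let ?\<rho> = "reverse_cycle k \<sigma>"
  have p: "permutation \<sigma>" using assms by (auto simp: permutation_permutes)
  have inj: "inj \<sigma>" "inj ?\<rho>"
    using assms(1) reverse_cycle_permutes[OF assms] by (auto intro: permutes_inj)
  have "?\<rho> (\<sigma> x) = x" if "x \<in> set (cycle_from \<sigma> k)"
    using apply_in_cycle_from[OF p that] inj by (simp add: reverse_cycle_def)
  then have "inv_into UNIV ?\<rho> x = \<sigma> x" if "x \<in> set (cycle_from \<sigma> k)"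
    using that inj by (metis inv_f_f)
  then show "reverse_cycle k ?\<rho> x = \<sigma> x"
    by (simp add: reverse_cycle_def[of _ ?\<rho>] set_cycle_from_reverse_cycle[OF assms])
       (simp add: reverse_cycle_def)
qed

section \<open>Merging and splitting cycles by a transposition\<close>

text \<open>Composition with the transposition exchanges the values \<open>i\<close> and
  \<open>k\<close>: the last element of the cycle of \<open>i\<close> now leads to \<open>k\<close>,
  and that of the cycle of \<open>k\<close> leads back to \<open>i\<close>.\<close>

lemma cycle_from_transpose_merge:
  assumes "permutation \<sigma>" "k \<notin> set (cycle_from \<sigma> i)"
  shows "cycle_from (transpose i k \<circ> \<sigma>) i = cycle_from \<sigma> i @ cycle_from \<sigma> k"
proof -
  obtain xs where xs: "cycle_from \<sigma> i = i # xs" "i \<notin> set xs" "distinct xs"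
    "map \<sigma> (i # xs) = xs @ [i]"
    using cycle_from_Cons[OF assms(1)] by metis
  obtain ys where ys: "cycle_from \<sigma> k = k # ys" "k \<notin> set ys" "distinct ys"
    "map \<sigma> (k # ys) = ys @ [k]"
    using cycle_from_Cons[OF assms(1)] by metis
  have disj: "set (i # xs) \<inter> set (k # ys) = {}"
    using cycle_from_disjoint[OF assms] xs ys by auto
  have id: "map (transpose i k) zs = zs" if "i \<notin> set zs" "k \<notin> set zs" for zs
    using that by (intro map_idI) (auto simp: transpose_def)
  have "map (transpose i k \<circ> \<sigma>) ((i # xs) @ (k # ys)) =
      map (transpose i k) (map \<sigma> (i # xs)) @ map (transpose i k) (map \<sigma> (k # ys))"
    by simp
  also have "\<dots> = rotate1 ((i # xs) @ (k # ys))"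
    unfolding xs(4) ys(4) using disj xs(2) ys(2) by (simp add: id)
  finally have "is_cycle (transpose i k \<circ> \<sigma>) ((i # xs) @ (k # ys))"
    using disj xs ys by (auto simp: is_cycle_def)
  from cycle_from_unique[OF this] xs(1) ys(1) show ?thesis by simp
qed

text \<open>The predecessor of \<open>k\<close> is now sent to \<open>i\<close>, so the cycle closes
  just before it would reach \<open>k\<close>.\<close>

lemma cycle_from_transpose_split:
  assumes "permutation \<sigma>" "k \<in> set (cycle_from \<sigma> i)" "k \<noteq> i"
  shows "k \<notin> set (cycle_from (transpose i k \<circ> \<sigma>) i)"
proof -
  obtain zs where zs: "cycle_from \<sigma> i = i # zs" "i \<notin> set zs" "distinct zs"
    "map \<sigma> (i # zs) = zs @ [i]"
    using cycle_from_Cons[OF assms(1)] by metis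
  then obtain xs ys where z: "zs = xs @ k # ys" using assms(2,3) by (auto dest: split_list)
  have "map \<sigma> (i # xs) @ map \<sigma> (k # ys) = (xs @ [k]) @ (ys @ [i])"
    using zs(4) by (simp add: z)
  then have m: "map \<sigma> (i # xs) = xs @ [k]"
    by (subst (asm) append_eq_append_conv) simp_all
  have "map (transpose i k \<circ> \<sigma>) (i # xs) = map (transpose i k) (map \<sigma> (i # xs))" by simp
  also have "\<dots> = rotate1 (i # xs)"
    unfolding m using zs(2,3) z
    by (auto simp: transpose_def intro!: map_idI)
  finally have "is_cycle (transpose i k \<circ> \<sigma>) (i # xs)"
    using zs(2,3) z by (simp add: is_cycle_def)
  from cycle_from_unique[OF this] show ?thesis using zs(3) z assms(3) by auto
qed

section \<open>Products along walks\<close>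

lemma qcnj_one [simp]: "qcnj 1 = 1" and qcnj_zero [simp]: "qcnj 0 = 0"
  and qcnj_mult: "qcnj (x * y) = qcnj y * qcnj x" and qcnj_add: "qcnj (x + y) = qcnj x + qcnj y"
  and qcnj_qcnj [simp]: "qcnj (qcnj x) = x"
  and add_qcnj: "x + qcnj x = of_real (2 * qre x)"
  by (simp_all add: quat_eq_iff one_quat_def times_quat_def of_real_def scaleR_quat_def)

lemma qre_mult_commute: "qre (x * y) = qre (y * x)"
  by (simp add: times_quat_def)

lemma of_real_quat_commute: "of_real r * (x :: quat) = x * of_real r"
  by (simp add: quat_eq_iff one_quat_def times_quat_def of_real_def scaleR_quat_def)

text \<open>Each pair of neighbours contributes one entry, so a cycle becomes a closed walk with its
  opener repeated at the end. Unlike \<open>cycle_product\<close>, this form does not mention the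
  permutation and can be cut, glued and reversed as a list.\<close>

fun walk_prod :: "quat mat \<Rightarrow> nat list \<Rightarrow> quat" where
  "walk_prod A [] = 1"
| "walk_prod A [x] = 1"
| "walk_prod A (x # y # zs) = A $$ (x, y) * walk_prod A (y # zs)"

lemma walk_prod_append: "walk_prod A (xs @ x # ys) = walk_prod A (xs @ [x]) * walk_prod A (x # ys)"
proof (induction xs)
  case (Cons a xs)
  then show ?case by (cases xs) (simp_all add: mult.assoc)
qed simp

lemma walk_prod_rev:
  assumes "\<And>a b. a \<in> set zs \<Longrightarrow> b \<in> set zs \<Longrightarrow> A $$ (b, a) = qcnj (A $$ (a, b))"
  shows "walk_prod A (rev zs) = qcnj (walk_prod A zs)"
  using assms
proof (induction A zs rule: walk_prod.induct)
  case (3 A x y zs)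
  have "walk_prod A (rev (x # y # zs)) = walk_prod A (rev (y # zs)) * A $$ (y, x)"
    using walk_prod_append[of A "rev zs" y "[x]"] by simp
  moreover have "walk_prod A (rev (y # zs)) = qcnj (walk_prod A (y # zs))"
    by (rule 3(1), rule 3(2)) auto
  moreover have "A $$ (y, x) = qcnj (A $$ (x, y))" by (rule 3(2)) auto
  ultimately show ?case by (simp add: qcnj_mult)
qed simp_all

text \<open>The first vertex of a walk only serves as a row index. A walk that starts at
  \<open>i\<close> and does not return there never reads column \<open>i\<close>.\<close>

lemma walk_prod_cong:
  assumes "\<And>a b. a \<in> set zs \<Longrightarrow> b \<in> set (tl zs) \<Longrightarrow> A $$ (a, b) = A' $$ (a, b)"
  shows "walk_prod A zs = walk_prod A' zs"
  using assms
proof (induction A zs rule: walk_prod.induct)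
  case (3 A x y zs)
  then have "walk_prod A (y # zs) = walk_prod A' (y # zs)"
    by (intro 3) auto
  then show ?case using 3(2)[of x y] by simp
qed simp_all

lemma prod_list_map_eq_walk_prod:
  "map \<sigma> (x # xs) = xs @ [b] \<Longrightarrow>
    prod_list (map (\<lambda>l. A $$ (l, \<sigma> l)) (x # xs)) = walk_prod A (x # xs @ [b])"
  by (induction xs arbitrary: x) auto

lemma cycle_product_eq_walk_prod:
  assumes "permutation \<sigma>"
  shows "cycle_product A \<sigma> k = walk_prod A (cycle_from \<sigma> k @ [k])"
proof -
  obtain ys where "cycle_from \<sigma> k = k # ys" "map \<sigma> (k # ys) = ys @ [k]"
    using cycle_from_Cons[OF assms(1)] by metis
  then show ?thesis
    using prod_list_map_eq_walk_prod[of \<sigma> k ys k A]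
    by (simp add: cycle_product_def flip: cycle_from_def)
qed

text \<open>Opening the cycle at another element exchanges the two arcs of the closed walk, and
  \<open>qre (x * y) = qre (y * x)\<close>.\<close>

lemma qre_cycle_product_eq:
  assumes "permutation \<sigma>" "l \<in> set (cycle_from \<sigma> k)"
  shows "qre (cycle_product A \<sigma> l) = qre (cycle_product A \<sigma> k)"
proof (cases "l = k")
  case False
  obtain us vs where e: "cycle_from \<sigma> k = us @ l # vs" using assms(2) by (meson split_list)
  with False obtain us' where us: "us = k # us'"
    using cycle_from_Cons[OF assms(1), of k] by (cases us) auto
  have l: "cycle_from \<sigma> l = l # vs @ us" by (rule cycle_from_rotate[OF assms(1) e])
  have "cycle_product A \<sigma> k = walk_prod A (us @ [l]) * walk_prod A (l # vs @ [k])"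
    using e walk_prod_append[of A us l "vs @ [k]"]
    by (simp add: cycle_product_eq_walk_prod[OF assms(1)])
  moreover have "cycle_product A \<sigma> l = walk_prod A (l # vs @ [k]) * walk_prod A (us @ [l])"
    using walk_prod_append[of A "l # vs" k "us' @ [l]"] l us
    by (simp add: cycle_product_eq_walk_prod[OF assms(1)])
  ultimately show ?thesis by (simp add: qre_mult_commute)
qed simp

text \<open>The reversed walk reads the transposed entries in the opposite order, which is what
  conjugation does to a product. Symmetry is asked for on this cycle only, so that matrices with one
  foreign column are covered.\<close>

lemma cycle_product_reverse_cycle_same:
  assumes "\<sigma> permutes S" "finite S"
    and "\<And>a b. a \<in> set (cycle_from \<sigma> k) \<Longrightarrow> b \<in> set (cycle_from \<sigma> k) \<Longrightarrow>
      A $$ (b, a) = qcnj (A $$ (a, b))"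
  shows "cycle_product A (reverse_cycle k \<sigma>) k = qcnj (cycle_product A \<sigma> k)"
proof -
  have p: "permutation \<sigma>" and p': "permutation (reverse_cycle k \<sigma>)"
    using assms(1,2) reverse_cycle_permutes[OF assms(1,2)] by (auto simp: permutation_permutes)
  obtain ys where ys: "cycle_from \<sigma> k = k # ys" using cycle_from_Cons[OF p] by metis
  have "walk_prod A (rev (k # ys @ [k])) = qcnj (walk_prod A (k # ys @ [k]))"
    by (rule walk_prod_rev, rule assms(3)) (auto simp: ys)
  then show ?thesis
    using ys by (simp add: cycle_product_eq_walk_prod[OF p] cycle_product_eq_walk_prod[OF p']
        cycle_from_reverse_cycle_same[OF p])
qed

lemma cycle_product_reverse_cycle_other:
  assumes "\<sigma> permutes S" "finite S" "l \<notin> set (cycle_from \<sigma> k)"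
  shows "cycle_product A (reverse_cycle k \<sigma>) l = cycle_product A \<sigma> l"
proof -
  have p: "permutation \<sigma>" and p': "permutation (reverse_cycle k \<sigma>)"
    using assms(1,2) reverse_cycle_permutes[OF assms(1,2)] by (auto simp: permutation_permutes)
  show ?thesis
    by (simp add: cycle_product_eq_walk_prod[OF p] cycle_product_eq_walk_prod[OF p']
        cycle_from_reverse_cycle_other[OF p assms(3)])
qed

text \<open>
  The maps \<open>\<phi> k\<close> are involutions that conjugate the factor with index \<open>k\<close> and leave everything else
  alone, so averaging over them replaces that factor by its real part.
\<close>

lemma sum_prod_list_real_parts:
  fixes c :: "'a \<Rightarrow> quat" and F :: "'a \<Rightarrow> 'b \<Rightarrow> quat"
  assumes "finite K" "finite S" "\<And>\<sigma>. \<sigma> \<in> S \<Longrightarrow> distinct (L \<sigma>)"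
    and "\<And>k \<sigma>. k \<in> K \<Longrightarrow> \<sigma> \<in> S \<Longrightarrow> k \<in> set (L \<sigma>) \<Longrightarrow>
      \<phi> k \<sigma> \<in> S \<and> \<phi> k (\<phi> k \<sigma>) = \<sigma> \<and> L (\<phi> k \<sigma>) = L \<sigma> \<and> c (\<phi> k \<sigma>) = c \<sigma> \<and>
      F (\<phi> k \<sigma>) k = qcnj (F \<sigma> k) \<and> (\<forall>l \<in> set (L \<sigma>) - {k}. F (\<phi> k \<sigma>) l = F \<sigma> l)"
  shows "(\<Sum>\<sigma>\<in>S. c \<sigma> * prod_list (map (F \<sigma>) (L \<sigma>))) =
    (\<Sum>\<sigma>\<in>S. c \<sigma> * prod_list (map (\<lambda>l. if l \<in> K then of_real (qre (F \<sigma> l)) else F \<sigma> l) (L \<sigma>)))"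
  using assms(1,4)
proof (induction K rule: finite_induct)
  case (insert k K)
  \<comment> \<open>\<open>H K\<close> gives the factors once the indices in \<open>K\<close> have
    been averaged, and \<open>G K\<close> is the resulting summand.\<close>
  define H where "H K \<sigma> l = (if l \<in> K then of_real (qre (F \<sigma> l)) else F \<sigma> l)" for K \<sigma> l
  define G where "G K \<sigma> = c \<sigma> * prod_list (map (H K \<sigma>) (L \<sigma>))" for K \<sigma>
  define S1 where "S1 = {\<sigma> \<in> S. k \<in> set (L \<sigma>)}"
  have fin: "finite S1" "finite (S - S1)" using assms(2) by (auto simp: S1_def)
  have \<phi>: "\<phi> k \<sigma> \<in> S1 \<and> \<phi> k (\<phi> k \<sigma>) = \<sigma>" if "\<sigma> \<in> S1" for \<sigma>
    using insert.prems[of k \<sigma>] that by (auto simp: S1_def)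
  have pair: "G K \<sigma> + G K (\<phi> k \<sigma>) = 2 * G (insert k K) \<sigma>" if "\<sigma> \<in> S1" for \<sigma>
  proof -
    have \<sigma>: "\<sigma> \<in> S" "k \<in> set (L \<sigma>)" using that by (auto simp: S1_def)
    then obtain us vs where L: "L \<sigma> = us @ k # vs" by (meson split_list)
    have k: "k \<notin> set us" "k \<notin> set vs" using assms(3)[OF \<sigma>(1)] L by auto
    note inv = insert.prems[of k \<sigma>, OF _ \<sigma>, simplified]
    have eq: "map (H K (\<phi> k \<sigma>)) ws = map (H K \<sigma>) ws"
      "map (H (insert k K) \<sigma>) ws = map (H K \<sigma>) ws" if "ws = us \<or> ws = vs" for ws
    proof -
      have "x \<in> set (L \<sigma>) - {k}" if "x \<in> set ws" for x
        using that \<open>ws = us \<or> ws = vs\<close> L k by auto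
      then show "map (H K (\<phi> k \<sigma>)) ws = map (H K \<sigma>) ws"
        "map (H (insert k K) \<sigma>) ws = map (H K \<sigma>) ws"
        using inv by (auto simp: H_def)
    qed
    \<comment> \<open>Only the factor at \<open>k\<close> differs between \<open>\<sigma>\<close>
      and \<open>\<phi> k \<sigma>\<close>, so the two summands combine by distributivity inside a
      fixed context; nothing is commuted.\<close>
    have "F \<sigma> k + qcnj (F \<sigma> k) = 2 * of_real (qre (F \<sigma> k))" by (simp add: add_qcnj)
    then have "c \<sigma> * prod_list (map (H K \<sigma>) us) * (F \<sigma> k + qcnj (F \<sigma> k)) * prod_list (map (H K \<sigma>) vs)
      = c \<sigma> * prod_list (map (H K \<sigma>) us) * (2 * of_real (qre (F \<sigma> k))) * prod_list (map (H K \<sigma>) vs)"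
      by simp
    moreover have "H K \<sigma> k = F \<sigma> k" "H K (\<phi> k \<sigma>) k = qcnj (F \<sigma> k)"
      "H (insert k K) \<sigma> k = of_real (qre (F \<sigma> k))"
      using insert.hyps inv by (simp_all add: H_def)
    moreover have "L (\<phi> k \<sigma>) = L \<sigma>" "c (\<phi> k \<sigma>) = c \<sigma>" using inv by blast+
    ultimately show ?thesis
      by (simp add: G_def L eq mult.assoc mult_2 distrib_left distrib_right)
  qed
  \<comment> \<open>Fixed points of \<open>\<phi> k\<close> (reversing a cycle of length one or two
    changes nothing) need no separate case: the whole sum is reindexed and doubled, and the factor
    two is cancelled.\<close>
  have "sum (G K) S1 = (\<Sum>\<sigma>\<in>S1. G K (\<phi> k \<sigma>))"
    by (rule sum.reindex_bij_witness[of _ "\<phi> k" "\<phi> k"]) (use \<phi> in auto)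
  then have "2 * sum (G K) S1 = (\<Sum>\<sigma>\<in>S1. G K \<sigma> + G K (\<phi> k \<sigma>))"
    by (simp add: sum.distrib mult_2)
  also have "\<dots> = 2 * sum (G (insert k K)) S1"
    by (simp add: pair sum_distrib_left)
  finally have "sum (G K) S1 = sum (G (insert k K)) S1" by simp
  moreover have "sum (G K) (S - S1) = sum (G (insert k K)) (S - S1)"
  proof (rule sum.cong)
    fix \<sigma> assume "\<sigma> \<in> S - S1"
    then have "map (H K \<sigma>) (L \<sigma>) = map (H (insert k K) \<sigma>) (L \<sigma>)"
      by (auto simp: S1_def H_def)
    then show "G K \<sigma> = G (insert k K) \<sigma>" by (simp only: G_def)
  qed simp
  ultimately have "sum (G K) S = sum (G (insert k K)) S"
    using sum.subset_diff[of S1 S "G K"] sum.subset_diff[of S1 S "G (insert k K)"] assms(2)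
    by (auto simp: S1_def)
  moreover have "(\<Sum>\<sigma>\<in>S. c \<sigma> * prod_list (map (F \<sigma>) (L \<sigma>))) = sum (G K) S"
    using insert.IH insert.prems by (simp add: G_def H_def[abs_def])
  ultimately show ?case by (simp add: G_def H_def[abs_def])
qed simp


section \<open>Openers of the cycles\<close>

text \<open>A list of openers that does not depend on a distinguished index.
  \<open>openers n i\<close> arises from it by dropping the minimum of the cycle of \<open>i\<close>
  and putting \<open>i\<close> in front, which makes determinants for different \<open>i\<close>
  comparable.\<close>

definition cycle_mins :: "nat \<Rightarrow> (nat \<Rightarrow> nat) \<Rightarrow> nat list" where
  "cycle_mins n \<sigma> = filter (\<lambda>k. \<forall>l \<in> set (cycle_from \<sigma> k). k \<le> l) [0..<n]"

lemma openers_eq: "openers n i \<sigma> = i # filter (\<lambda>k. k \<notin> set (cycle_from \<sigma> i)) (cycle_mins n \<sigma>)"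
  unfolding openers_def cycle_mins_def cycle_from_def filter_filter
  by (intro arg_cong2[where f = "(#)"] filter_cong) auto

lemma distinct_cycle_mins [simp]: "distinct (cycle_mins n \<sigma>)"
  by (simp add: cycle_mins_def)

lemma set_cycle_mins_subset: "set (cycle_mins n \<sigma>) \<subseteq> {0..<n}"
  by (auto simp: cycle_mins_def)

lemma cycle_mins_distinct_cycles:
  assumes "permutation \<sigma>" "l \<in> set (cycle_mins n \<sigma>)" "m \<in> set (cycle_mins n \<sigma>)" "l \<noteq> m"
  shows "l \<notin> set (cycle_from \<sigma> m)"
proof
  assume "l \<in> set (cycle_from \<sigma> m)"
  moreover from this have "m \<in> set (cycle_from \<sigma> l)"
    using set_cycle_from_eq[OF assms(1)] assms(1) by simp
  ultimately show False using assms(2-4) by (fastforce simp: cycle_mins_def)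
qed

lemma cycle_mins_Int_cycle_from:
  assumes "\<sigma> permutes {0..<n}" "k < n"
  obtains m where "set (cycle_mins n \<sigma>) \<inter> set (cycle_from \<sigma> k) = {m}"
proof
  have p: "permutation \<sigma>" using assms(1) by (auto simp: permutation_permutes)
  let ?C = "set (cycle_from \<sigma> k)"
  let ?m = "Min ?C"
  have ne: "?C \<noteq> {}" using in_cycle_from_self[OF p, of k] by auto
  then have m: "?m \<in> ?C" by simp
  moreover have "?m < n" using m cycle_from_subset[OF assms(1), of k] assms(2) by auto
  ultimately have "?m \<in> set (cycle_mins n \<sigma>)"
    using set_cycle_from_eq[OF p m] by (simp add: cycle_mins_def)
  moreover have "l = ?m" if "l \<in> set (cycle_mins n \<sigma>)" "l \<in> ?C" for l
    using that m \<open>?m \<in> set (cycle_mins n \<sigma>)\<close> cycle_mins_distinct_cycles[OF p, of l n ?m]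
      set_cycle_from_eq[OF p m] by auto
  ultimately show "set (cycle_mins n \<sigma>) \<inter> ?C = {?m}" using m by blast
qed

text \<open>In use, \<open>C\<close> is a cycle and \<open>m\<close> its minimum; the commutative
  products are those of real parts.\<close>

lemma prod_list_filter_out_singleton:
  fixes f :: "'a \<Rightarrow> 'b :: comm_monoid_mult"
  assumes "distinct xs" "set xs \<inter> C = {m}"
  shows "prod_list (map f xs) = f m * prod_list (map f (filter (\<lambda>x. x \<notin> C) xs))"
    and "length xs = Suc (length (filter (\<lambda>x. x \<notin> C) xs))"
proof -
  have e: "set xs = insert m (set (filter (\<lambda>x. x \<notin> C) xs))" "m \<notin> set (filter (\<lambda>x. x \<notin> C) xs)"
    using assms(2) by auto
  have "prod f (set xs) = f m * prod f (set (filter (\<lambda>x. x \<notin> C) xs))"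
    by (subst e(1)) (use e(2) in simp)
  then show "prod_list (map f xs) = f m * prod_list (map f (filter (\<lambda>x. x \<notin> C) xs))"
    using assms(1) by (simp add: prod.distinct_set_conv_list del: set_filter)
  have "card (set xs) = Suc (card (set (filter (\<lambda>x. x \<notin> C) xs)))"
    by (subst e(1)) (use e(2) in simp)
  then show "length xs = Suc (length (filter (\<lambda>x. x \<notin> C) xs))"
    using assms(1) by (simp add: distinct_card del: set_filter)
qed

lemma openers_props:
  assumes "\<sigma> permutes {0..<n}" "i < n"
  shows "distinct (openers n i \<sigma>)" "set (openers n i \<sigma>) \<subseteq> {0..<n}"
    and "length (openers n i \<sigma>) = length (cycle_mins n \<sigma>)"
    and "\<lbrakk>l \<in> set (openers n i \<sigma>); m \<in> set (openers n i \<sigma>); l \<noteq> m\<rbrakk> \<Longrightarrow> l \<notin> set (cycle_from \<sigma> m)"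
proof -
  have p: "permutation \<sigma>" using assms(1) by (auto simp: permutation_permutes)
  show "distinct (openers n i \<sigma>)" using p by (simp add: openers_eq)
  show "set (openers n i \<sigma>) \<subseteq> {0..<n}"
    using set_cycle_mins_subset assms(2) by (auto simp: openers_eq)
  obtain j where "set (cycle_mins n \<sigma>) \<inter> set (cycle_from \<sigma> i) = {j}"
    using cycle_mins_Int_cycle_from[OF assms] .
  from prod_list_filter_out_singleton(2)[OF distinct_cycle_mins this]
  show "length (openers n i \<sigma>) = length (cycle_mins n \<sigma>)" by (simp add: openers_eq)
  assume "l \<in> set (openers n i \<sigma>)" "m \<in> set (openers n i \<sigma>)" "l \<noteq> m"
  moreover have "i \<notin> set (cycle_from \<sigma> m)" if "m \<notin> set (cycle_from \<sigma> i)" for m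
    using that set_cycle_from_eq[OF p, of i m] in_cycle_from_self[OF p, of m] by auto
  ultimately show "l \<notin> set (cycle_from \<sigma> m)"
    using cycle_mins_distinct_cycles[OF p, of l n m] by (auto simp: openers_eq)
qed

text \<open>Since \<open>f\<close> is real and constant on the cycle of \<open>i\<close>, neither
  the exchange of its minimum for \<open>i\<close> nor the new position of that factor
  matters.\<close>

lemma prod_list_openers:
  fixes f :: "nat \<Rightarrow> real"
  assumes "\<sigma> permutes {0..<n}" "i < n" "\<And>l. l \<in> set (cycle_from \<sigma> i) \<Longrightarrow> f l = f i"
  shows "prod_list (map f (openers n i \<sigma>)) = prod_list (map f (cycle_mins n \<sigma>))"
proof -
  obtain m where m: "set (cycle_mins n \<sigma>) \<inter> set (cycle_from \<sigma> i) = {m}"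
    using cycle_mins_Int_cycle_from[OF assms(1,2)] .
  then have "f m = f i" using assms(3) by blast
  with prod_list_filter_out_singleton(1)[OF distinct_cycle_mins m, of f] show ?thesis
    by (simp add: openers_eq)
qed

lemma cycle_mins_reverse_cycle:
  assumes "\<sigma> permutes {0..<n}"
  shows "cycle_mins n (reverse_cycle k \<sigma>) = cycle_mins n \<sigma>"
  by (simp add: cycle_mins_def set_cycle_from_reverse_cycle[OF assms])

lemma openers_reverse_cycle:
  assumes "\<sigma> permutes {0..<n}"
  shows "openers n i (reverse_cycle k \<sigma>) = openers n i \<sigma>"
  by (simp add: openers_eq cycle_mins_reverse_cycle[OF assms] set_cycle_from_reverse_cycle[OF assms])

text \<open>\<open>S\<close>, \<open>L\<close> and \<open>K\<close> are left general for the sake of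
  a matrix with a replaced column: there only cycles avoiding that column are symmetric, so
  \<open>K\<close> omits one index and the sum runs over some of the permutations only.\<close>

lemma sum_cycle_products_real_parts:
  fixes c :: "(nat \<Rightarrow> nat) \<Rightarrow> quat"
  assumes "S \<subseteq> {\<sigma>. \<sigma> permutes {0..<n}}" "finite K" "\<And>\<sigma>. \<sigma> \<in> S \<Longrightarrow> distinct (L \<sigma>)"
    and "\<And>\<sigma> k. \<sigma> \<in> S \<Longrightarrow> reverse_cycle k \<sigma> \<in> S \<and> L (reverse_cycle k \<sigma>) = L \<sigma> \<and> c (reverse_cycle k \<sigma>) = c \<sigma>"
    and "\<And>\<sigma> k l. \<sigma> \<in> S \<Longrightarrow> k \<in> set (L \<sigma>) \<Longrightarrow> l \<in> set (L \<sigma>) \<Longrightarrow> l \<noteq> k \<Longrightarrow> l \<notin> set (cycle_from \<sigma> k)"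
    and "\<And>\<sigma> k a b. \<sigma> \<in> S \<Longrightarrow> k \<in> K \<Longrightarrow> k \<in> set (L \<sigma>) \<Longrightarrow> a \<in> set (cycle_from \<sigma> k) \<Longrightarrow>
      b \<in> set (cycle_from \<sigma> k) \<Longrightarrow> A $$ (b, a) = qcnj (A $$ (a, b))"
  shows "(\<Sum>\<sigma>\<in>S. c \<sigma> * prod_list (map (cycle_product A \<sigma>) (L \<sigma>))) =
    (\<Sum>\<sigma>\<in>S. c \<sigma> * prod_list (map (\<lambda>l. if l \<in> K then of_real (qre (cycle_product A \<sigma> l))
      else cycle_product A \<sigma> l) (L \<sigma>)))"
proof (rule sum_prod_list_real_parts[where \<phi> = reverse_cycle])
  show "finite S" using assms(1) by (rule finite_subset) (simp add: finite_permutations)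
next
  fix k \<sigma> assume k: "k \<in> K" "\<sigma> \<in> S" "k \<in> set (L \<sigma>)"
  then have \<sigma>: "\<sigma> permutes {0..<n}" using assms(1) by auto
  have "reverse_cycle k (reverse_cycle k \<sigma>) = \<sigma>"
    by (rule reverse_cycle_reverse_cycle[OF \<sigma>]) simp
  moreover have "cycle_product A (reverse_cycle k \<sigma>) k = qcnj (cycle_product A \<sigma> k)"
    by (rule cycle_product_reverse_cycle_same[OF \<sigma>], simp, rule assms(6)[OF k(2,1,3)])
  moreover have "cycle_product A (reverse_cycle k \<sigma>) l = cycle_product A \<sigma> l"
    if "l \<in> set (L \<sigma>) - {k}" for l
    using that by (intro cycle_product_reverse_cycle_other[OF \<sigma>] assms(5)[OF k(2,3)]) auto
  ultimately show "reverse_cycle k \<sigma> \<in> S \<and> reverse_cycle k (reverse_cycle k \<sigma>) = \<sigma> \<and>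
      L (reverse_cycle k \<sigma>) = L \<sigma> \<and> c (reverse_cycle k \<sigma>) = c \<sigma> \<and>
      cycle_product A (reverse_cycle k \<sigma>) k = qcnj (cycle_product A \<sigma> k) \<and>
      (\<forall>l\<in>set (L \<sigma>) - {k}. cycle_product A (reverse_cycle k \<sigma>) l = cycle_product A \<sigma> l)"
    using assms(4)[OF k(2)] by blast
qed (fact assms(2), rule assms(3))

section \<open>The determinant of a Hermitian matrix\<close>

lemma prod_list_of_real:
  "prod_list (map (\<lambda>x. of_real (f x) :: 'a :: real_algebra_1) xs) = of_real (prod_list (map f xs))"
  by (induction xs) simp_all

text \<open>The common value of all row and column determinants of a Hermitian matrix in closed
  form: every cycle enters through the real part of its product, so neither openers nor order have
  an influence.\<close>

definition cycle_det :: "nat \<Rightarrow> quat mat \<Rightarrow> real" where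
  "cycle_det n M = (\<Sum>\<sigma> | \<sigma> permutes {0..<n}. (-1) ^ (n - length (cycle_mins n \<sigma>)) *
     prod_list (map (\<lambda>l. qre (cycle_product M \<sigma> l)) (cycle_mins n \<sigma>)))"

text \<open>\<open>g\<close> is the identity for \<open>rdet\<close> and \<open>rev\<close> for
  \<open>cdet\<close>. Once all factors are real, only the multiset of openers counts.\<close>

lemma sum_openers_hermitian:
  assumes "i < n" "\<And>a b. a < n \<Longrightarrow> b < n \<Longrightarrow> M $$ (b, a) = qcnj (M $$ (a, b))"
    and "\<And>xs. mset (g xs) = mset xs"
  shows "(\<Sum>\<sigma> | \<sigma> permutes {0..<n}. (-1) ^ (n - length (openers n i \<sigma>)) *
     prod_list (map (cycle_product M \<sigma>) (g (openers n i \<sigma>)))) = of_real (cycle_det n M)"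
proof -
  let ?S = "{\<sigma>. \<sigma> permutes {0..<n}}"
  have set_g: "set (g xs) = set xs" and distinct_g: "distinct (g xs) = distinct xs" for xs
    using mset_eq_setD[OF assms(3)] mset_eq_imp_distinct_iff[OF assms(3)] by auto
  have "(\<Sum>\<sigma>\<in>?S. (-1) ^ (n - length (openers n i \<sigma>)) *
     prod_list (map (cycle_product M \<sigma>) (g (openers n i \<sigma>)))) =
     (\<Sum>\<sigma>\<in>?S. (-1) ^ (n - length (openers n i \<sigma>)) *
     prod_list (map (\<lambda>l. if l \<in> {0..<n} then of_real (qre (cycle_product M \<sigma> l))
       else cycle_product M \<sigma> l) (g (openers n i \<sigma>))))"
  proof (rule sum_cycle_products_real_parts[where n = n])
    fix \<sigma> k a b
    assume "\<sigma> \<in> ?S" "k \<in> {0..<n}" "a \<in> set (cycle_from \<sigma> k)" "b \<in> set (cycle_from \<sigma> k)"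
    then show "M $$ (b, a) = qcnj (M $$ (a, b))"
      using cycle_from_subset[of \<sigma> "{0..<n}" k] by (intro assms(2)) auto
  qed (auto simp: set_g distinct_g openers_reverse_cycle openers_props[OF _ assms(1)]
      intro: reverse_cycle_permutes)
  also have "\<dots> = (\<Sum>\<sigma>\<in>?S. of_real ((-1) ^ (n - length (cycle_mins n \<sigma>)) *
     prod_list (map (\<lambda>l. qre (cycle_product M \<sigma> l)) (cycle_mins n \<sigma>))))"
  proof (rule sum.cong)
    fix \<sigma> assume "\<sigma> \<in> ?S"
    then have \<sigma>: "\<sigma> permutes {0..<n}" by simp
    then have p: "permutation \<sigma>" by (auto simp: permutation_permutes)
    have "map (\<lambda>l. if l \<in> {0..<n} then of_real (qre (cycle_product M \<sigma> l))
       else cycle_product M \<sigma> l) (g (openers n i \<sigma>)) =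
      map (\<lambda>l. of_real (qre (cycle_product M \<sigma> l))) (g (openers n i \<sigma>))"
      using openers_props(2)[OF \<sigma> assms(1)] by (auto simp: set_g)
    moreover have "prod_list (map (\<lambda>l. qre (cycle_product M \<sigma> l)) (g (openers n i \<sigma>))) =
      prod_list (map (\<lambda>l. qre (cycle_product M \<sigma> l)) (openers n i \<sigma>))"
      by (simp add: assms(3) flip: prod_mset_prod_list)
    moreover have "\<dots> = prod_list (map (\<lambda>l. qre (cycle_product M \<sigma> l)) (cycle_mins n \<sigma>))"
      by (intro prod_list_openers[OF \<sigma> assms(1)] qre_cycle_product_eq[OF p])
    ultimately show "(-1) ^ (n - length (openers n i \<sigma>)) *
       prod_list (map (\<lambda>l. if l \<in> {0..<n} then of_real (qre (cycle_product M \<sigma> l))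
       else cycle_product M \<sigma> l) (g (openers n i \<sigma>))) =
      (of_real ((-1) ^ (n - length (cycle_mins n \<sigma>)) *
     prod_list (map (\<lambda>l. qre (cycle_product M \<sigma> l)) (cycle_mins n \<sigma>))) :: quat)"
      by (simp only: openers_props(3)[OF \<sigma> assms(1)] prod_list_of_real) simp
  qed simp
  finally show ?thesis by (simp add: cycle_det_def)
qed

lemma
  assumes "M \<in> carrier_mat n n" "\<And>a b. a < n \<Longrightarrow> b < n \<Longrightarrow> M $$ (b, a) = qcnj (M $$ (a, b))" "i < n"
  shows rdet_hermitian: "rdet i M = of_real (cycle_det n M)"
    and cdet_hermitian: "cdet i M = of_real (cycle_det n M)"
proof -
  have n: "dim_row M = n" using assms(1) by simp
  show "rdet i M = of_real (cycle_det n M)"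
    unfolding rdet_def n by (rule sum_openers_hermitian[OF assms(3,2)]) simp_all
  show "cdet i M = of_real (cycle_det n M)"
    unfolding cdet_def n by (rule sum_openers_hermitian[OF assms(3,2)]) simp_all
qed

text \<open>The bound \<open>n \<ge> 1\<close> provides the index 0, whose row determinant pins down
  the value in the definite description; for an empty matrix every real would qualify.\<close>

lemma hdet_hermitian:
  assumes "M \<in> carrier_mat n n" "\<And>a b. a < n \<Longrightarrow> b < n \<Longrightarrow> M $$ (b, a) = qcnj (M $$ (a, b))" "n \<ge> 1"
  shows "hdet M = cycle_det n M"
  unfolding hdet_def
proof (rule the_equality)
  show "\<forall>i<dim_row M. rdet i M = of_real (cycle_det n M) \<and> cdet i M = of_real (cycle_det n M)"
    using rdet_hermitian[OF assms(1,2)] cdet_hermitian[OF assms(1,2)] assms(1) by auto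
  fix d assume "\<forall>i<dim_row M. rdet i M = of_real d \<and> cdet i M = of_real d"
  then have "rdet 0 M = of_real d" using assms by auto
  then show "d = cycle_det n M" using rdet_hermitian[OF assms(1,2), of 0] assms(3) by simp
qed

section \<open>Vanishing of the column determinant for two equal columns\<close>

text \<open>The final vertex enters only as the column index of the last factor, so it may be
  exchanged between two equal columns.\<close>

lemma walk_prod_change_last:
  assumes "zs \<noteq> []" "A $$ (last zs, i) = A $$ (last zs, k)"
  shows "walk_prod A (zs @ [i]) = walk_prod A (zs @ [k])"
proof -
  obtain us u where "zs = us @ [u]" using assms(1) by (metis rev_exhaust)
  then show ?thesis
    using walk_prod_append[of A us u "[i]"] walk_prod_append[of A us u "[k]"] assms(2) by simp
qed

text \<open>
  Composition with \<open>transpose i k\<close> pairs the permutations with \<open>i\<close> and \<open>k\<close> in one cycle with those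
  having them in different cycles. As the columns \<open>i\<close> and \<open>k\<close> agree, the product along the common
  cycle is the product along the cycle of \<open>i\<close> times that along the cycle of \<open>k\<close>; after taking real
  parts of the latter the paired terms cancel.
\<close>

lemma cdet_eq_columns:
  assumes N: "N \<in> carrier_mat n n" and ik: "i < n" "k < n" "i \<noteq> k"
    and col: "\<And>a. a < n \<Longrightarrow> N $$ (a, i) = N $$ (a, k)"
    and herm: "\<And>a b. a < n \<Longrightarrow> b < n \<Longrightarrow> a \<noteq> i \<Longrightarrow> b \<noteq> i \<Longrightarrow> N $$ (b, a) = qcnj (N $$ (a, b))"
  shows "cdet i N = 0"
proof -
  define P where "P = {\<sigma>. \<sigma> permutes {0..<n}}"
  define B where "B = {\<sigma> \<in> P. k \<notin> set (cycle_from \<sigma> i)}"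
  define T where "T \<sigma> = (-1) ^ (n - length (openers n i \<sigma>)) *
     prod_list (map (cycle_product N \<sigma>) (rev (openers n i \<sigma>)))" for \<sigma>
  define R where "R \<sigma> = filter (\<lambda>k. k \<notin> set (cycle_from \<sigma> i)) (cycle_mins n \<sigma>)" for \<sigma>
  define R' where "R' \<sigma> = filter (\<lambda>l. l \<notin> set (cycle_from \<sigma> k)) (R \<sigma>)" for \<sigma>
  define q where "q \<sigma> l = qre (cycle_product N \<sigma> l)" for \<sigma> l
  \<comment> \<open>The index \<open>i\<close> is left out because column \<open>i\<close> breaks
    the Hermitian symmetry; the factor of its cycle is never averaged.\<close>
  define K where "K = {0..<n} - {i}"
  define H where "H \<sigma> l = (if l \<in> K then of_real (qre (cycle_product N \<sigma> l)) else cycle_product N \<sigma> l)" for \<sigma> l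
  let ?\<tau> = "\<lambda>\<sigma>. transpose i k \<circ> \<sigma>"
  have finP: "finite P" by (simp add: P_def finite_permutations)
  have perm: "permutation \<sigma>" if "\<sigma> \<in> P" for \<sigma>
    using that by (auto simp: permutation_permutes P_def)
  have \<tau>P: "?\<tau> \<sigma> \<in> P" if "\<sigma> \<in> P" for \<sigma>
    using that ik unfolding P_def by (auto intro!: permutes_compose permutes_swap_id)
  have \<tau>\<tau>: "?\<tau> (?\<tau> \<sigma>) = \<sigma>" for \<sigma> by (simp add: fun_eq_iff)
  have openers: "openers n i \<sigma> = i # R \<sigma>" for \<sigma> by (simp add: openers_eq R_def)

  \<comment> \<open>Merging removes the opener of the cycle of \<open>k\<close> from the list; its
    factor reappears directly after that of \<open>i\<close>, at the far right and opened at
    \<open>k\<close> instead of at its minimum.\<close>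
  have T\<tau>: "T (?\<tau> \<sigma>) = (-1) ^ (n - Suc (length (R' \<sigma>))) *
      prod_list (map (cycle_product N \<sigma>) (rev (R' \<sigma>) @ [i, k]))" if "\<sigma> \<in> B" for \<sigma>
  proof -
    have \<sigma>: "\<sigma> \<in> P" "k \<notin> set (cycle_from \<sigma> i)" using that by (auto simp: B_def)
    note p = perm[OF \<sigma>(1)] and p' = perm[OF \<tau>P[OF \<sigma>(1)]]
    let ?U = "set (cycle_from \<sigma> i) \<union> set (cycle_from \<sigma> k)"
    have merge: "cycle_from (?\<tau> \<sigma>) i = cycle_from \<sigma> i @ cycle_from \<sigma> k"
      by (rule cycle_from_transpose_merge[OF p \<sigma>(2)])
    have same: "cycle_from (?\<tau> \<sigma>) x = cycle_from \<sigma> x" if "x \<notin> ?U" for x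
    proof (rule cycle_from_cong[OF p])
      fix y assume "y \<in> set (cycle_from \<sigma> x)"
      then have "\<sigma> y \<in> set (cycle_from \<sigma> x)" by (rule apply_in_cycle_from[OF p])
      moreover have "i \<notin> set (cycle_from \<sigma> x)" "k \<notin> set (cycle_from \<sigma> x)"
        using that cycle_from_disjoint[OF p, of x i] cycle_from_disjoint[OF p, of x k]
          in_cycle_from_self[OF p] by blast+
      ultimately show "?\<tau> \<sigma> y = \<sigma> y" by (auto simp: transpose_def)
    qed
    have "R (?\<tau> \<sigma>) = R' \<sigma>"
      unfolding R_def R'_def cycle_mins_def merge filter_filter
      by (rule filter_cong) (auto simp: same)
    moreover have "prod_list (map (cycle_product N (?\<tau> \<sigma>)) (rev (R' \<sigma>))) =
        prod_list (map (cycle_product N \<sigma>) (rev (R' \<sigma>)))"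
      using same by (intro arg_cong[where f = prod_list] map_cong) (auto simp: R'_def R_def cycle_product_eq_walk_prod[OF p]
          cycle_product_eq_walk_prod[OF p'])
    moreover have "cycle_product N (?\<tau> \<sigma>) i = cycle_product N \<sigma> i * cycle_product N \<sigma> k"
    proof -
      obtain ys where ys: "cycle_from \<sigma> k = k # ys" using cycle_from_Cons[OF p] by metis
      let ?xs = "cycle_from \<sigma> i"
      have sub: "set ?xs \<subseteq> {0..<n}" "set (k # ys) \<subseteq> {0..<n}"
        using cycle_from_subset[of \<sigma> "{0..<n}" i] cycle_from_subset[of \<sigma> "{0..<n}" k] \<sigma>(1) ik ys
        by (auto simp: P_def)
      have ne: "?xs \<noteq> []" using in_cycle_from_self[OF p, of i] by auto
      have "last ?xs < n" "last (k # ys) < n"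
        using sub last_in_set[OF ne] last_in_set[of "k # ys"] by auto
      \<comment> \<open>As the columns agree, each closed walk may end at the opener of the other;
        glued at \<open>k\<close>, the two form the merged cycle.\<close>
      then have "walk_prod N (?xs @ [i]) = walk_prod N (?xs @ [k])"
        "walk_prod N ((k # ys) @ [i]) = walk_prod N ((k # ys) @ [k])"
        by (intro walk_prod_change_last col; simp add: ne)+
      then show ?thesis
        using walk_prod_append[of N ?xs k "ys @ [i]"] ys
        by (simp add: cycle_product_eq_walk_prod[OF p] cycle_product_eq_walk_prod[OF p'] merge)
    qed
    ultimately show ?thesis by (simp add: T_def openers)
  qed

  have rev: "reverse_cycle l \<sigma> \<in> B" "R (reverse_cycle l \<sigma>) = R \<sigma>" "R' (reverse_cycle l \<sigma>) = R' \<sigma>"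
    if "\<sigma> \<in> B" for \<sigma> l
  proof -
    have \<sigma>: "\<sigma> permutes {0..<n}" using that by (simp add: B_def P_def)
    note s = set_cycle_from_reverse_cycle[OF \<sigma>, simplified] cycle_mins_reverse_cycle[OF \<sigma>]
    show "reverse_cycle l \<sigma> \<in> B" "R (reverse_cycle l \<sigma>) = R \<sigma>" "R' (reverse_cycle l \<sigma>) = R' \<sigma>"
      using that reverse_cycle_permutes[OF \<sigma>] by (auto simp: s B_def P_def R_def R'_def)
  qed
  have herm_cycle: "N $$ (b, a) = qcnj (N $$ (a, b))"
    if "\<sigma> \<in> P" "l \<in> K" "l \<notin> set (cycle_from \<sigma> i)" "a \<in> set (cycle_from \<sigma> l)" "b \<in> set (cycle_from \<sigma> l)"
    for \<sigma> l a b
  proof (rule herm)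
    have "set (cycle_from \<sigma> l) \<subseteq> {0..<n}"
      using that cycle_from_subset[of \<sigma> "{0..<n}" l] by (auto simp: P_def K_def)
    moreover have "i \<notin> set (cycle_from \<sigma> l)"
      using cycle_from_disjoint[OF perm[OF that(1)] that(3)] in_cycle_from_self[OF perm[OF that(1)]]
      by blast
    ultimately show "a < n" "b < n" "a \<noteq> i" "b \<noteq> i" using that(4,5) by auto
  qed
  have props: "distinct (R \<sigma>)" "set (R \<sigma>) \<subseteq> K" "set (R' \<sigma>) \<subseteq> set (R \<sigma>)" "distinct (R' \<sigma>)"
    "i \<notin> set (R \<sigma>)" "k \<notin> set (R' \<sigma>)"
    "\<And>l. l \<in> set (R \<sigma>) \<Longrightarrow> l \<notin> set (cycle_from \<sigma> i) \<and> i \<notin> set (cycle_from \<sigma> l)"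
    "\<And>l. l \<in> set (R' \<sigma>) \<Longrightarrow> l \<notin> set (cycle_from \<sigma> k) \<and> k \<notin> set (cycle_from \<sigma> l)"
    "\<And>l m. l \<in> set (R \<sigma>) \<Longrightarrow> m \<in> set (R \<sigma>) \<Longrightarrow> l \<noteq> m \<Longrightarrow> l \<notin> set (cycle_from \<sigma> m)"
    "i \<notin> set (cycle_from \<sigma> k)"
    if "\<sigma> \<in> B" for \<sigma>
  proof -
    have \<sigma>: "\<sigma> \<in> P" "k \<notin> set (cycle_from \<sigma> i)" using that by (auto simp: B_def)
    note p = perm[OF \<sigma>(1)]
    have sym: "l \<notin> set (cycle_from \<sigma> m)" if "m \<notin> set (cycle_from \<sigma> l)" for l m
      using that set_cycle_from_eq[OF p, of l m] in_cycle_from_self[OF p, of m] by auto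
    show "distinct (R \<sigma>)" "distinct (R' \<sigma>)" "set (R' \<sigma>) \<subseteq> set (R \<sigma>)" "i \<notin> set (R \<sigma>)" "k \<notin> set (R' \<sigma>)"
      "set (R \<sigma>) \<subseteq> K" using p set_cycle_mins_subset[of n \<sigma>] by (auto simp: R_def R'_def K_def)
    show "i \<notin> set (cycle_from \<sigma> k)" by (rule sym[OF \<sigma>(2)])
    show "l \<notin> set (cycle_from \<sigma> i) \<and> i \<notin> set (cycle_from \<sigma> l)" if "l \<in> set (R \<sigma>)" for l
      using that sym[of l i] by (auto simp: R_def)
    show "l \<notin> set (cycle_from \<sigma> k) \<and> k \<notin> set (cycle_from \<sigma> l)" if "l \<in> set (R' \<sigma>)" for l
      using that sym[of l k] by (auto simp: R'_def)
    show "l \<notin> set (cycle_from \<sigma> m)" if "l \<in> set (R \<sigma>)" "m \<in> set (R \<sigma>)" "l \<noteq> m" for l m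
      using that cycle_mins_distinct_cycles[OF p, of l n m] by (auto simp: R_def)
  qed
  have kK: "k \<in> K" and iK: "i \<notin> K" using ik by (auto simp: K_def)

  have "sum T B = (\<Sum>\<sigma>\<in>B. (-1) ^ (n - Suc (length (R \<sigma>))) *
      prod_list (map (cycle_product N \<sigma>) (rev (R \<sigma>) @ [i])))"
    by (simp add: T_def openers)
  also have "\<dots> = (\<Sum>\<sigma>\<in>B. (-1) ^ (n - Suc (length (R \<sigma>))) * prod_list (map (H \<sigma>) (rev (R \<sigma>) @ [i])))"
    unfolding H_def[abs_def]
  proof (rule sum_cycle_products_real_parts[where n = n])
    fix \<sigma> l a b assume l: "\<sigma> \<in> B" "l \<in> K" "l \<in> set (rev (R \<sigma>) @ [i])"
      "a \<in> set (cycle_from \<sigma> l)" "b \<in> set (cycle_from \<sigma> l)"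
    moreover from l have "l \<notin> set (cycle_from \<sigma> i)" using props(7)[OF l(1), of l] iK by auto
    ultimately show "N $$ (b, a) = qcnj (N $$ (a, b))"
      by (intro herm_cycle[of \<sigma> l]) (auto simp: B_def)
  next
    fix \<sigma> l m assume "\<sigma> \<in> B" "l \<in> set (rev (R \<sigma>) @ [i])" "m \<in> set (rev (R \<sigma>) @ [i])" "m \<noteq> l"
    then show "m \<notin> set (cycle_from \<sigma> l)"
      using props(7,9)[of \<sigma>] by auto
  next
    fix \<sigma> assume "\<sigma> \<in> B"
    then show "distinct (rev (R \<sigma>) @ [i])" using props(1,5)[of \<sigma>] by auto
  qed (auto simp: rev, auto simp: B_def P_def K_def)
  finally have sumB: "sum T B = (\<Sum>\<sigma>\<in>B. (-1) ^ (n - Suc (length (R \<sigma>))) *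
    prod_list (map (H \<sigma>) (rev (R \<sigma>) @ [i])))" .

  have "sum T (P - B) = (\<Sum>\<sigma>\<in>B. T (?\<tau> \<sigma>))"
  proof (rule sum.reindex_bij_witness[of _ ?\<tau> ?\<tau>])
    fix \<sigma> assume "\<sigma> \<in> P - B"
    then show "?\<tau> \<sigma> \<in> B"
      using \<tau>P cycle_from_transpose_split[OF perm, of \<sigma> k i] ik by (auto simp: B_def)
  next
    fix \<sigma> assume "\<sigma> \<in> B"
    then show "?\<tau> \<sigma> \<in> P - B"
      using \<tau>P cycle_from_transpose_merge[OF perm, of \<sigma> k i] in_cycle_from_self[OF perm, of \<sigma> k]
      by (auto simp: B_def)
  qed (simp_all only: \<tau>\<tau>)
  also have "\<dots> = (\<Sum>\<sigma>\<in>B. (-1) ^ (n - Suc (length (R' \<sigma>))) *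
      prod_list (map (cycle_product N \<sigma>) (rev (R' \<sigma>) @ [i, k])))"
    by (simp only: T\<tau> cong: sum.cong)
  also have "\<dots> = (\<Sum>\<sigma>\<in>B. (-1) ^ (n - Suc (length (R' \<sigma>))) *
      prod_list (map (H \<sigma>) (rev (R' \<sigma>) @ [i, k])))"
    unfolding H_def[abs_def]
  proof (rule sum_cycle_products_real_parts[where n = n])
    fix \<sigma> l a b assume l: "\<sigma> \<in> B" "l \<in> K" "l \<in> set (rev (R' \<sigma>) @ [i, k])"
      "a \<in> set (cycle_from \<sigma> l)" "b \<in> set (cycle_from \<sigma> l)"
    moreover from l have "l \<notin> set (cycle_from \<sigma> i)"
      using props(7)[OF l(1), of l] props(3)[OF l(1)] iK by (auto simp: B_def)
    ultimately show "N $$ (b, a) = qcnj (N $$ (a, b))"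
      by (intro herm_cycle[of \<sigma> l]) (auto simp: B_def)
  next
    fix \<sigma> l m
    assume l: "\<sigma> \<in> B" "l \<in> set (rev (R' \<sigma>) @ [i, k])" "m \<in> set (rev (R' \<sigma>) @ [i, k])" "m \<noteq> l"
    note pr = props[OF l(1)]
    from l(2,3) consider "l \<in> set (R' \<sigma>)" "m \<in> set (R' \<sigma>)" | "l \<in> set (R' \<sigma>)" "m = i"
      | "l \<in> set (R' \<sigma>)" "m = k" | "m \<in> set (R' \<sigma>)" "l = i" | "m \<in> set (R' \<sigma>)" "l = k"
      | "l = i" "m = k" | "l = k" "m = i" using l(4) by auto
    then show "m \<notin> set (cycle_from \<sigma> l)"
    proof cases
      case 1
      then show ?thesis using pr(9)[of m l] pr(3) l(4) by blast
    qed (use l(1) pr(7)[of l] pr(7)[of m] pr(8)[of l] pr(8)[of m] pr(3,10) in \<open>auto simp: B_def\<close>)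
  next
    fix \<sigma> assume "\<sigma> \<in> B"
    then show "distinct (rev (R' \<sigma>) @ [i, k])"
      using props(3-6)[of \<sigma>] ik(3) by auto
  qed (auto simp: rev, auto simp: B_def P_def K_def)
  also have "\<dots> = (\<Sum>\<sigma>\<in>B. - ((-1) ^ (n - Suc (length (R \<sigma>))) * prod_list (map (H \<sigma>) (rev (R \<sigma>) @ [i]))))"
  proof (rule sum.cong)
    fix \<sigma> assume B: "\<sigma> \<in> B"
    then have \<sigma>: "\<sigma> permutes {0..<n}" "k \<notin> set (cycle_from \<sigma> i)" by (auto simp: B_def P_def)
    have p: "permutation \<sigma>" using B perm by (simp add: B_def)
    obtain m where m: "set (cycle_mins n \<sigma>) \<inter> set (cycle_from \<sigma> k) = {m}"
      using cycle_mins_Int_cycle_from[OF \<sigma>(1) ik(2)] .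
    then have "set (R \<sigma>) \<inter> set (cycle_from \<sigma> k) = {m}"
      using cycle_from_disjoint[OF p \<sigma>(2)] by (auto simp: R_def)
    note R = prod_list_filter_out_singleton[OF props(1)[OF B] this, folded R'_def]
    \<comment> \<open>The factor of this cycle is opened at \<open>m\<close> in
      \<open>R \<sigma>\<close> and at \<open>k\<close> in the merged product; the real part does
      not see the difference.\<close>
    have "q \<sigma> m = q \<sigma> k" using m qre_cycle_product_eq[OF p, of m k] by (auto simp: q_def)
    then have qR: "prod_list (map (q \<sigma>) (R \<sigma>)) = q \<sigma> k * prod_list (map (q \<sigma>) (R' \<sigma>))"
      using R(1)[of "q \<sigma>"] by simp
    have HK: "prod_list (map (H \<sigma>) (rev ls)) = of_real (prod_list (map (q \<sigma>) ls))" if "set ls \<subseteq> K" for ls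
    proof -
      have "map (H \<sigma>) (rev ls) = map (\<lambda>l. of_real (q \<sigma> l)) (rev ls)"
        using that by (auto simp: H_def q_def)
      then have "prod_list (map (H \<sigma>) (rev ls)) = of_real (prod_list (map (q \<sigma>) (rev ls)))"
        by (simp only: prod_list_of_real)
      then show ?thesis by (simp flip: prod_mset_prod_list)
    qed
    \<comment> \<open>This bound makes the truncated subtraction genuine: one cycle fewer raises the
      exponent by exactly one, which is the change of sign.\<close>
    have "length (i # R \<sigma>) \<le> n"
      using openers_props(1,2)[OF \<sigma>(1) ik(1)] card_mono[of "{0..<n}" "set (openers n i \<sigma>)"]
      by (simp add: openers distinct_card del: set_simps)
    then have "n - Suc (length (R' \<sigma>)) = Suc (n - Suc (length (R \<sigma>)))"
      using R(2) by simp
    moreover have "prod_list (map (H \<sigma>) (rev (R \<sigma>) @ [i])) = prod_list (map (H \<sigma>) (rev (R' \<sigma>) @ [i, k]))"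
    proof -
      \<comment> \<open>Being real, the factor of \<open>k\<close> can be moved past the unaveraged
        factor of \<open>i\<close>.\<close>
      have "prod_list (map (H \<sigma>) (rev (R' \<sigma>) @ [i, k])) =
        of_real (prod_list (map (q \<sigma>) (R' \<sigma>))) * (H \<sigma> i * of_real (q \<sigma> k))"
        using HK[of "R' \<sigma>"] props(2,3)[OF B] kK by (simp add: H_def q_def subset_trans)
      also have "\<dots> = of_real (prod_list (map (q \<sigma>) (R' \<sigma>))) * of_real (q \<sigma> k) * H \<sigma> i"
        by (simp only: mult.assoc of_real_quat_commute[of "q \<sigma> k" "H \<sigma> i"])
      also have "\<dots> = of_real (prod_list (map (q \<sigma>) (R \<sigma>))) * H \<sigma> i"
        by (simp add: qR of_real_quat_commute[of "q \<sigma> k"])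
      finally show ?thesis using HK[of "R \<sigma>"] props(2)[OF B] by simp
    qed
    ultimately show "(-1) ^ (n - Suc (length (R' \<sigma>))) * prod_list (map (H \<sigma>) (rev (R' \<sigma>) @ [i, k])) =
       - ((-1) ^ (n - Suc (length (R \<sigma>))) * prod_list (map (H \<sigma>) (rev (R \<sigma>) @ [i])))"
      by (simp only: power_Suc) simp
  qed simp
  also have "\<dots> = - sum T B" by (simp only: sumB sum_negf)
  finally have "sum T P = 0"
    using sum.subset_diff[of B P T] finP by (simp add: B_def)
  then show ?thesis using N by (simp add: cdet_def T_def P_def)
qed


section \<open>Cramer's rule\<close>

text \<open>Every summand reads column \<open>i\<close> exactly once, when the cycle opened at
  \<open>i\<close> closes, and \<open>cdet i\<close> puts this factor at the far right. All other
  factors come from \<open>M\<close>, so the coefficients do not depend on \<open>v\<close>.\<close>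

lemma cdet_replace_col_linear:
  assumes M: "M \<in> carrier_mat n n" and i: "i < n"
  obtains c where "\<And>v. cdet i (replace_col M v i) = (\<Sum>u<n. c u * v $ u)"
proof -
  define P where "P = {\<sigma>. \<sigma> permutes {0..<n}}"
  define R where "R \<sigma> = filter (\<lambda>k. k \<notin> set (cycle_from \<sigma> i)) (cycle_mins n \<sigma>)" for \<sigma>
  \<comment> \<open>\<open>C \<sigma>\<close> is the summand without its final factor;
    \<open>w \<sigma>\<close>, the preimage of \<open>i\<close>, is the row in which that factor is
    read from \<open>v\<close>.\<close>
  define C where "C \<sigma> = (-1) ^ (n - Suc (length (R \<sigma>))) *
    prod_list (map (cycle_product M \<sigma>) (rev (R \<sigma>))) * walk_prod M (cycle_from \<sigma> i)" for \<sigma>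
  define w where "w \<sigma> = last (cycle_from \<sigma> i)" for \<sigma>
  have finP: "finite P" by (simp add: P_def finite_permutations)
  have perm: "permutation \<sigma>" if "\<sigma> \<in> P" for \<sigma>
    using that by (auto simp: permutation_permutes P_def)
  have sub: "set (cycle_from \<sigma> l) \<subseteq> {0..<n}" if "\<sigma> \<in> P" "l < n" for \<sigma> l
    using that cycle_from_subset[of \<sigma> "{0..<n}" l] by (simp add: P_def)
  have w: "w \<sigma> < n" if "\<sigma> \<in> P" for \<sigma>
    using sub[OF that i] in_cycle_from_self[OF perm[OF that], of i]
      last_in_set[of "cycle_from \<sigma> i"] by (fastforce simp: w_def)
  have "cdet i (replace_col M v i) = (\<Sum>u<n. (\<Sum>\<sigma> | \<sigma> \<in> P \<and> w \<sigma> = u. C \<sigma>) * v $ u)" for v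
  proof -
    let ?N = "replace_col M v i"
    have N: "?N $$ (a, b) = (if b = i then v $ a else M $$ (a, b))" if "a < n" "b < n" for a b
      using that M by (simp add: replace_col_def)
    have dim: "dim_row ?N = n" using M by (simp add: replace_col_def)
    have "(-1) ^ (n - length (openers n i \<sigma>)) *
        prod_list (map (cycle_product ?N \<sigma>) (rev (openers n i \<sigma>))) = C \<sigma> * v $ w \<sigma>"
      if "\<sigma> \<in> P" for \<sigma>
    proof -
      note p = perm[OF that]
      have "cycle_product ?N \<sigma> l = cycle_product M \<sigma> l" if l: "l \<in> set (R \<sigma>)" for l
      proof -
        have "l < n" using l set_cycle_mins_subset[of n \<sigma>] by (auto simp: R_def)
        then have s: "set (cycle_from \<sigma> l) \<subseteq> {0..<n}" using sub \<open>\<sigma> \<in> P\<close> by blast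
        have "i \<notin> set (cycle_from \<sigma> l)"
          using l cycle_from_disjoint[OF p, of l i] in_cycle_from_self[OF p, of i] by (auto simp: R_def)
        moreover have "set (cycle_from \<sigma> l @ [l]) = set (cycle_from \<sigma> l)" using p by auto
        moreover have "set (tl (cycle_from \<sigma> l @ [l])) \<subseteq> set (cycle_from \<sigma> l @ [l])"
          by (cases "cycle_from \<sigma> l") auto
        ultimately have ab: "a < n \<and> b < n \<and> b \<noteq> i"
          if "a \<in> set (cycle_from \<sigma> l @ [l])" "b \<in> set (tl (cycle_from \<sigma> l @ [l]))" for a b
          using that s by (metis atLeastLessThan_iff subsetD)
        have "walk_prod ?N (cycle_from \<sigma> l @ [l]) = walk_prod M (cycle_from \<sigma> l @ [l])"
          by (rule walk_prod_cong) (simp only: N ab simp_thms if_False)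
        then show ?thesis by (simp add: cycle_product_eq_walk_prod[OF p])
      qed
      then have R: "prod_list (map (cycle_product ?N \<sigma>) (rev (R \<sigma>))) =
          prod_list (map (cycle_product M \<sigma>) (rev (R \<sigma>)))"
        by (intro arg_cong[where f = prod_list] map_cong) auto
      obtain ys where ys: "cycle_from \<sigma> i = i # ys" "i \<notin> set ys" using cycle_from_Cons[OF p] by metis
      have "walk_prod ?N (i # ys) = walk_prod M (i # ys)"
      proof (rule walk_prod_cong)
        fix a b assume "a \<in> set (i # ys)" "b \<in> set (tl (i # ys))"
        then have "a < n" "b < n" "b \<noteq> i" using ys sub[OF that i] by auto
        then show "?N $$ (a, b) = M $$ (a, b)" by (simp add: N)
      qed
      moreover obtain us where us: "i # ys = us @ [w \<sigma>]"
        using append_butlast_last_id[of "i # ys"] ys(1) unfolding w_def by (metis list.distinct(1))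
      have "walk_prod ?N ((i # ys) @ [i]) = walk_prod ?N (i # ys) * v $ w \<sigma>"
        unfolding us using walk_prod_append[of ?N us "w \<sigma>" "[i]"] w[OF that] i by (simp add: N)
      ultimately have "cycle_product ?N \<sigma> i = walk_prod M (cycle_from \<sigma> i) * v $ w \<sigma>"
        using ys(1) by (simp add: cycle_product_eq_walk_prod[OF p])
      then show ?thesis
        by (simp add: openers_eq C_def R mult.assoc flip: R_def)
    qed
    then have "cdet i ?N = (\<Sum>\<sigma>\<in>P. C \<sigma> * v $ w \<sigma>)"
      unfolding cdet_def dim by (intro sum.cong) (auto simp: P_def)
    also have "\<dots> = (\<Sum>u<n. \<Sum>\<sigma> | \<sigma> \<in> P \<and> w \<sigma> = u. C \<sigma> * v $ w \<sigma>)"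
      by (rule sum.group[symmetric]) (use finP w in auto)
    also have "\<dots> = (\<Sum>u<n. (\<Sum>\<sigma> | \<sigma> \<in> P \<and> w \<sigma> = u. C \<sigma>) * v $ u)"
      by (intro sum.cong refl) (simp add: sum_distrib_right)
    finally show ?thesis .
  qed
  then show ?thesis by (rule that)
qed

text \<open>The rows of \<open>L\<close> are the coefficients of the linear forms
  \<open>cdet i\<close>, scaled by the inverse determinant. On column \<open>k\<close> of
  \<open>M\<close> such a form yields the determinant if \<open>k = i\<close>, and otherwise zero
  because two columns coincide.\<close>

lemma hermitian_left_inverse:
  assumes M: "M \<in> carrier_mat n n"
    and herm: "\<And>a b. a < n \<Longrightarrow> b < n \<Longrightarrow> M $$ (b, a) = qcnj (M $$ (a, b))"
    and d: "cycle_det n M \<noteq> 0"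
  obtains L where "L \<in> carrier_mat n n" "L * M = 1\<^sub>m n"
    "\<And>v i. v \<in> carrier_vec n \<Longrightarrow> i < n \<Longrightarrow>
      (L *\<^sub>v v) $ i = cdet i (replace_col M v i) / of_real (cycle_det n M)"
proof -
  let ?d = "cycle_det n M"
  have "\<forall>i. \<exists>c. i < n \<longrightarrow> (\<forall>v. cdet i (replace_col M v i) = (\<Sum>u<n. c u * v $ u))"
    using cdet_replace_col_linear[OF M] by metis
  then obtain c where c: "\<And>i v. i < n \<Longrightarrow> cdet i (replace_col M v i) = (\<Sum>u<n. c i u * v $ u)"
    by metis
  define L where "L = mat n n (\<lambda>(i, u). of_real (inverse ?d) * c i u)"
  have L: "L \<in> carrier_mat n n" by (simp add: L_def)
  have Lv: "(L *\<^sub>v v) $ i = cdet i (replace_col M v i) / of_real ?d"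
    if "v \<in> carrier_vec n" "i < n" for v i
  proof -
    have "(L *\<^sub>v v) $ i = of_real (inverse ?d) * cdet i (replace_col M v i)"
      using that by (simp add: L_def scalar_prod_def c sum_distrib_left mult.assoc atLeast0LessThan)
    \<comment> \<open>Division multiplies by the inverse on the right; being real, this scalar may
      change sides.\<close>
    then show ?thesis
      unfolding of_real_quat_commute by (simp only: divide_quat_def of_real_inverse)
  qed
  have "cdet i (replace_col M (col M k) i) = (if i = k then of_real ?d else 0)"
    if "i < n" "k < n" for i k
  proof (cases "i = k")
    case True
    have "replace_col M (col M i) i = M"
      by (rule eq_matI) (use M in \<open>auto simp: replace_col_def\<close>)
    then show ?thesis using True cdet_hermitian[OF M herm that(1)] by simp
  next
    case False
    have "cdet i (replace_col M (col M k) i) = 0"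
    proof (rule cdet_eq_columns[of _ n i k])
      fix a b assume "a < n" "b < n" "a \<noteq> i" "b \<noteq> i"
      then show "replace_col M (col M k) i $$ (b, a) = qcnj (replace_col M (col M k) i $$ (a, b))"
        using M herm[of a b] by (simp add: replace_col_def)
    qed (use M that False in \<open>auto simp: replace_col_def\<close>)
    then show ?thesis using False by simp
  qed
  then have "(L *\<^sub>v col M k) $ i = (if i = k then 1 else 0)" if "i < n" "k < n" for i k
    using that Lv[OF col_carrier_vec[OF that(2) M] that(1)] d by simp
  then have "L * M = 1\<^sub>m n"
    using L M by (intro eq_matI) auto
  with L Lv show ?thesis using that by blast
qed

section \<open>Adjoints of quaternion matrices\<close>

lemma adjoint_qmat_carrier [simp]: "A \<in> carrier_mat n m \<Longrightarrow> adjoint_qmat A \<in> carrier_mat m n"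
  by (simp add: adjoint_qmat_def)

lemma adjoint_qmat_index [simp]:
  "A \<in> carrier_mat n m \<Longrightarrow> i < m \<Longrightarrow> j < n \<Longrightarrow> adjoint_qmat A $$ (i, j) = qcnj (A $$ (j, i))"
  by (simp add: adjoint_qmat_def)

lemma adjoint_adjoint_qmat: "A \<in> carrier_mat n m \<Longrightarrow> adjoint_qmat (adjoint_qmat A) = A"
  by (rule eq_matI) (auto simp: adjoint_qmat_def)

lemma qcnj_sum: "qcnj (sum f S) = (\<Sum>x\<in>S. qcnj (f x))"
  by (induction S rule: infinite_finite_induct) (simp_all add: qcnj_add)

lemma qre_sum: "qre (sum f S) = (\<Sum>x\<in>S. qre (f x))"
  by (induction S rule: infinite_finite_induct) simp_all

lemma adjoint_qmat_mult:
  assumes "A \<in> carrier_mat n m" "B \<in> carrier_mat m l"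
  shows "adjoint_qmat (A * B) = adjoint_qmat B * adjoint_qmat A"
proof (rule eq_matI)
  fix i j assume "i < dim_row (adjoint_qmat B * adjoint_qmat A)" "j < dim_col (adjoint_qmat B * adjoint_qmat A)"
  then have ij: "i < l" "j < n" using assms by (auto simp: adjoint_qmat_def)
  have AB: "A * B \<in> carrier_mat n l" using assms by simp
  show "adjoint_qmat (A * B) $$ (i, j) = (adjoint_qmat B * adjoint_qmat A) $$ (i, j)"
    unfolding adjoint_qmat_index[OF AB ij] using assms ij
    by (auto simp: scalar_prod_def qcnj_sum qcnj_mult adjoint_qmat_def intro!: sum.cong)
qed (use assms in \<open>auto simp: adjoint_qmat_def\<close>)

lemma adjoint_qmat_one: "adjoint_qmat (1\<^sub>m n) = 1\<^sub>m n"
  by (rule eq_matI) (auto simp: adjoint_qmat_def)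

text \<open>
  The real trace \<open>tr\<close> is cyclic, so the Hermitian idempotent \<open>Q = 1 - A * C\<close> has
  \<open>tr (Q\<^sup>* * Q) = tr Q = 0\<close>, and the left-hand side is the sum of the squared norms of all entries.
\<close>

lemma hermitian_right_inverse:
  assumes A: "A \<in> carrier_mat n n" and C: "C \<in> carrier_mat n n"
    and CA: "C * A = 1\<^sub>m n" and herm: "adjoint_qmat (A * C) = A * C"
  shows "A * C = 1\<^sub>m n"
proof -
  \<comment> \<open>Only real parts are summed because the quaternion-valued trace is not
    cyclic.\<close>
  define tr where "tr X = (\<Sum>i<n. qre (X $$ (i, i)))" for X
  define P where "P = A * C"
  define Q where "Q = 1\<^sub>m n - P"
  have P: "P \<in> carrier_mat n n" and Q: "Q \<in> carrier_mat n n"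
    using A C by (auto simp: P_def Q_def)
  have "P * P = A * ((C * A) * C)"
    unfolding P_def using A C by (simp add: assoc_mult_mat[of _ n n _ n _ n])
  then have PP: "P * P = P" using C by (simp add: CA P_def)
  have QQ: "Q * Q = Q"
  proof -
    have "Q * Q = 1\<^sub>m n * Q - P * Q"
      unfolding Q_def using P by (intro minus_mult_distrib_mat) auto
    also have "P * Q = P * 1\<^sub>m n - P * P"
      unfolding Q_def using P by (intro mult_minus_distrib_mat) auto
    also have "\<dots> = 0\<^sub>m n n" using P PP by simp
    finally have "Q * Q = Q - 0\<^sub>m n n" using Q by simp
    also have "\<dots> = Q" using Q by (intro eq_matI) auto
    finally show ?thesis .
  qed
  have "qcnj (P $$ (j, i)) = P $$ (i, j)" if "i < n" "j < n" for i j
    using adjoint_qmat_index[OF P that] herm by (simp add: P_def)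
  then have Qh: "qcnj (Q $$ (j, i)) = Q $$ (i, j)" if "i < n" "j < n" for i j
    using that P by (auto simp: Q_def quat_eq_iff one_quat_def)
  have tr_mult: "tr (X * Y) = (\<Sum>i<n. \<Sum>j<n. qre (X $$ (i, j) * Y $$ (j, i)))"
    if "X \<in> carrier_mat n n" "Y \<in> carrier_mat n n" for X Y
    using that by (simp add: tr_def scalar_prod_def qre_sum atLeast0LessThan)
  have "tr P = tr (1\<^sub>m n)"
  proof -
    have "tr P = (\<Sum>i<n. \<Sum>j<n. qre (C $$ (j, i) * A $$ (i, j)))"
      unfolding P_def tr_mult[OF A C] by (intro sum.cong refl qre_mult_commute)
    also have "\<dots> = tr (C * A)"
      unfolding tr_mult[OF C A] by (rule sum.swap)
    finally show ?thesis by (simp add: CA)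
  qed
  then have "tr Q = 0"
    using P by (simp add: tr_def Q_def sum_subtractf)
  then have "tr (Q * Q) = 0" by (simp only: QQ)
  moreover have "tr (Q * Q) = (\<Sum>i<n. \<Sum>j<n. (qre (Q $$ (i, j)))\<^sup>2 + (qi (Q $$ (i, j)))\<^sup>2 +
      (qj (Q $$ (i, j)))\<^sup>2 + (qk (Q $$ (i, j)))\<^sup>2)"
    unfolding tr_mult[OF Q Q]
  proof (intro sum.cong refl)
    fix i j assume "i \<in> {..<n}" "j \<in> {..<n}"
    then have "Q $$ (j, i) = qcnj (Q $$ (i, j))" using Qh[of j i] by simp
    then show "qre (Q $$ (i, j) * Q $$ (j, i)) = (qre (Q $$ (i, j)))\<^sup>2 + (qi (Q $$ (i, j)))\<^sup>2 +
        (qj (Q $$ (i, j)))\<^sup>2 + (qk (Q $$ (i, j)))\<^sup>2"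
      by (simp add: times_quat_def power2_eq_square)
  qed
  ultimately have "\<forall>i<n. \<forall>j<n. (qre (Q $$ (i, j)))\<^sup>2 + (qi (Q $$ (i, j)))\<^sup>2 +
      (qj (Q $$ (i, j)))\<^sup>2 + (qk (Q $$ (i, j)))\<^sup>2 = 0"
    by (simp add: sum_nonneg_eq_0_iff sum_nonneg)
  then have "Q $$ (i, j) = 0" if "i < n" "j < n" for i j
    using that sq_sum_nonzero by blast
  then have "P $$ (i, j) = 1\<^sub>m n $$ (i, j)" if "i < n" "j < n" for i j
    using that P by (auto simp: Q_def)
  then show ?thesis
    using P by (intro eq_matI) (auto simp: P_def)
qed

theorem theorem3p1:
  fixes n :: nat and A B :: "quat mat"
  assumes "n \<ge> 1"
    and "A \<in> carrier_mat n n"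
    and "B \<in> carrier_mat n n"
    and "ddet A \<noteq> 0"
  shows "(\<exists>!X. X \<in> carrier_mat n n \<and> A * X = B) \<and>
    (\<forall>X \<in> carrier_mat n n. A * X = B \<longrightarrow>
      (\<forall>i < n. \<forall>j < n. X $$ (i, j) =
        cdet i (replace_col (adjoint_qmat A * A) (col (adjoint_qmat A * B) j) i)
          / of_real (ddet A)))"
proof -
  note A = assms(2) and B = assms(3)
  let ?A' = "adjoint_qmat A"
  define M where "M = ?A' * A"
  have A': "?A' \<in> carrier_mat n n" using A by simp
  have M: "M \<in> carrier_mat n n" unfolding M_def by (rule mult_carrier_mat[OF A' A])
  have adj: "adjoint_qmat M = M"
    using adjoint_qmat_mult[OF A' A] A by (simp add: M_def adjoint_adjoint_qmat)
  have herm: "M $$ (b, a) = qcnj (M $$ (a, b))" if "a < n" "b < n" for a b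
    using adjoint_qmat_index[OF M that(2,1)] adj by simp
  have d: "ddet A = cycle_det n M"
    using hdet_hermitian[OF M herm assms(1)] by (simp add: ddet_def M_def)
  obtain L where L: "L \<in> carrier_mat n n" "L * M = 1\<^sub>m n"
    and cramer: "\<And>v i. v \<in> carrier_vec n \<Longrightarrow> i < n \<Longrightarrow>
      (L *\<^sub>v v) $ i = cdet i (replace_col M v i) / of_real (ddet A)"
    using hermitian_left_inverse[OF M herm] assms(4) d by metis
  have L': "adjoint_qmat L \<in> carrier_mat n n" using L(1) by simp
  \<comment> \<open>The adjoint of \<open>L * M = 1\<^sub>m n\<close> makes
    \<open>adjoint_qmat L\<close> a right inverse of the Hermitian \<open>M\<close>; a left and a
    right inverse agree, so \<open>L\<close> is Hermitian.\<close>
  have "M * adjoint_qmat L = 1\<^sub>m n"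
    using arg_cong[OF L(2), of adjoint_qmat] adjoint_qmat_mult[OF L(1) M]
    by (simp add: adj adjoint_qmat_one)
  then have "L = L * (M * adjoint_qmat L)" using L(1) by simp
  also have "\<dots> = adjoint_qmat L"
    using assoc_mult_mat[OF L(1) M L'] L(2) L' by simp
  finally have adjL: "adjoint_qmat L = L" by simp
  \<comment> \<open>This is the least-squares inverse
    \<open>(A\<^sup>* * A)\<^sup>-\<^sup>1 * A\<^sup>*\<close>: a left inverse by construction, with
    \<open>A * C\<close> Hermitian.\<close>
  define C where "C = L * ?A'"
  have C: "C \<in> carrier_mat n n" unfolding C_def by (rule mult_carrier_mat[OF L(1) A'])
  have "C * A = 1\<^sub>m n"
    using assoc_mult_mat[OF L(1) A' A] L(2) by (simp add: C_def M_def)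
  moreover have "adjoint_qmat (A * C) = A * C"
    using adjoint_qmat_mult[OF A C] adjoint_qmat_mult[OF L(1) A'] assoc_mult_mat[OF A L(1) A'] A
    by (simp add: C_def adjL adjoint_adjoint_qmat)
  ultimately have AC: "A * C = 1\<^sub>m n" by (rule hermitian_right_inverse[OF A C])
  \<comment> \<open>Multiplying \<open>A * X = B\<close> by \<open>A\<^sup>*\<close> from the left
    gives the normal equation, which \<open>L\<close> solves. This form, unlike
    \<open>C * B\<close>, exposes the columns of \<open>A\<^sup>* * B\<close> to Cramer's
    rule.\<close>
  have sol: "X = L * (?A' * B)" if "X \<in> carrier_mat n n" "A * X = B" for X
  proof -
    have "L * (?A' * (A * X)) = L * (M * X)"
      using assoc_mult_mat[OF A' A that(1)] by (simp add: M_def)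
    also have "\<dots> = X"
      using assoc_mult_mat[OF L(1) M that(1)] L(2) that(1) by simp
    finally show ?thesis by (simp add: that(2))
  qed
  have CB: "C * B \<in> carrier_mat n n" "A * (C * B) = B"
    using assoc_mult_mat[OF A C B] AC B C by simp_all
  have unique: "X = C * B" if "X \<in> carrier_mat n n" "A * X = B" for X
    using sol[OF that] sol[OF CB] by (rule trans[OF _ sym])
  have "X $$ (i, j) = cdet i (replace_col M (col (?A' * B) j) i) / of_real (ddet A)"
    if "X \<in> carrier_mat n n" "A * X = B" "i < n" "j < n" for X i j
  proof -
    have "X $$ (i, j) = (L *\<^sub>v col (?A' * B) j) $ i"
      using sol[OF that(1,2)] that(3,4) L(1) A' B by simp
    also have "\<dots> = cdet i (replace_col M (col (?A' * B) j) i) / of_real (ddet A)"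
      by (rule cramer[OF col_carrier_vec[OF that(4) mult_carrier_mat[OF A' B]] that(3)])
    finally show ?thesis .
  qed
  then have "\<forall>X \<in> carrier_mat n n. A * X = B \<longrightarrow> (\<forall>i < n. \<forall>j < n.
      X $$ (i, j) = cdet i (replace_col M (col (?A' * B) j) i) / of_real (ddet A))"
    by blast
  moreover have "\<exists>!X. X \<in> carrier_mat n n \<and> A * X = B"
    using CB unique by (intro ex1I[of _ "C * B"]) blast+
  ultimately show ?thesis unfolding M_def by (rule conjI[rotated])
qed

end
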